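(* The monoid $\mathbf{Br}_n^B$ is isomorphic to the monoid $\mathbf{APB}_n(\mathbb{Z}_2)$.
   Context: Type $B$ Brauer monoid: write $\overline{x}=-x$ and $X=\{\overline n,\dots,\overline1,1,\dots,n\}$. A Brauer diagram on $X$ is a partition of $X\cup X'$ (where $X'$ is a disjoint copy of $X$) into two-element subsets. The product of two diagrams is given by concatenation: identify the primed vertices of the first diagram with the corresponding unprimed vertices of the second, take the induced partition of the remaining vertices into two-element subsets, and discard components supported only on the identified vertices. $\mathbf{Br}^B_n$ is the monoid of all Brauer diagrams on $X$ that are invariant under the swap $i\leftrightarrow\overline i$ (applied simultaneously to unprimed and primed vertices). Almost colored partial Brauer monoid: a partial Brauer diagram is a partition of $\underline n\cup\underline n'$ (with $\underline n=\{1,\dots,n\}$, $\underline n'=\{1',\dots,n'\}$) into singletons and two-element subsets. The product $\pi\pi'$ of two partial Brauer diagrams is given by concatenation: identify the primed vertices of $\pi$ with the corresponding unprimed vertices of $\pi'$, take the induced partition of the remaining vertices into singletons and two-element subsets, and discard components supported only on the identified vertices. For an abelian semigroup $G$, an almost $G$-coloring of a partial Brauer diagram $\pi$ is a map $f$ from the set of two-element parts of $\pi$ to $G$. The monoid $\mathbf{APB}_n(G)$ consists of all pairs $(\pi,f)$ with $\pi$ a partial Brauer diagram and $f$ an almost $G$-coloring of $\pi$; the product is $(\pi,f)(\pi',f')=(\pi\pi',\mathbf{f})$, where the value of $\mathbf{f}$ at a two-element part $C$ of $\pi\pi'$ is the product in $G$ of the values of $f$, respectively $f'$, over all two-element parts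 of $\pi$ and $\pi'$ that contributed to $C$. Here $\mathbb{Z}_2$ is the additive group of order two. *)

theory Defs
  imports "HOL-Algebra.Algebra" "HOL-Library.Disjoint_Sets"
begin

section \<open>Concatenation of set partitions\<close>

text \<open>
  A diagram on a vertex set \<open>V\<close> is a partition of \<open>V <+> V\<close>: the vertex \<open>i\<close> is \<open>Inl i\<close> and its
  primed copy is \<open>Inr i\<close>. To multiply \<open>P\<close> and \<open>Q\<close> they are stacked on three rows of vertices;
  the middle row is the result of identifying the primed vertices of \<open>P\<close> with the unprimed
  vertices of \<open>Q\<close>.
\<close>

datatype 'a stacked = Top 'a | Middle 'a | Bottom 'a

definition first_rows :: "'a + 'a \<Rightarrow> 'a stacked"
  where "first_rows = case_sum Top Middle"

definition last_rows :: "'a + 'a \<Rightarrow> 'a stacked"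
  where "last_rows = case_sum Middle Bottom"

definition outer_rows :: "'a + 'a \<Rightarrow> 'a stacked"
  where "outer_rows = case_sum Top Bottom"

definition stacked_blocks :: "('a + 'a) set set \<Rightarrow> ('a + 'a) set set \<Rightarrow> 'a stacked set set"
  where "stacked_blocks P Q = (\<lambda>B. first_rows ` B) ` P \<union> (\<lambda>B. last_rows ` B) ` Q"

definition connected_rel ::
    "('a + 'a) set set \<Rightarrow> ('a + 'a) set set \<Rightarrow> ('a stacked \<times> 'a stacked) set"
  where "connected_rel P Q = {(u, v). \<exists>B \<in> stacked_blocks P Q. u \<in> B \<and> v \<in> B}\<^sup>*"

definition components :: "('a + 'a) set set \<Rightarrow> ('a + 'a) set set \<Rightarrow> 'a stacked set set"
  where "components P Q = \<Union> (stacked_blocks P Q) // connected_rel P Q"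

text \<open>Components contained in the middle row have empty trace on the outer rows.\<close>

definition concatenation ::
    "('a + 'a) set set \<Rightarrow> ('a + 'a) set set \<Rightarrow> ('a + 'a) set set"
  where "concatenation P Q = (\<lambda>K. outer_rows -` K) ` components P Q - {{}}"

definition identity_diagram :: "'a set \<Rightarrow> ('a + 'a) set set"
  where "identity_diagram V = (\<lambda>i. {Inl i, Inr i}) ` V"


section \<open>Brauer diagrams of type B\<close>

definition brauer_diagrams :: "'a set \<Rightarrow> ('a + 'a) set set set"
  where "brauer_diagrams V = {P. partition_on (V <+> V) P \<and> (\<forall>B\<in>P. card B = 2)}"

definition signed_points :: "nat \<Rightarrow> int set"
  where "signed_points n = {- int n..int n} - {0}"

definition negate_diagram :: "(int + int) set set \<Rightarrow> (int + int) set set"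
  where "negate_diagram P = (\<lambda>B. map_sum uminus uminus ` B) ` P"

definition BrB :: "nat \<Rightarrow> (int + int) set set monoid"
  where "BrB n =
    \<lparr>carrier = {P \<in> brauer_diagrams (signed_points n). negate_diagram P = P},
     monoid.mult = concatenation,
     one = identity_diagram (signed_points n)\<rparr>"


section \<open>Almost colored partial Brauer diagrams\<close>

definition partial_brauer_diagrams :: "'a set \<Rightarrow> ('a + 'a) set set set"
  where "partial_brauer_diagrams V =
    {P. partition_on (V <+> V) P \<and> (\<forall>B\<in>P. card B = 1 \<or> card B = 2)}"

definition pair_blocks :: "('a + 'a) set set \<Rightarrow> ('a + 'a) set set"
  where "pair_blocks P = {B \<in> P. card B = 2}"

text \<open>
  The product of the values of \<open>f\<close> over a nonempty finite set \<open>A\<close>. The library's \<open>finprod\<close> starts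
  from the identity of \<open>G\<close>, which an abelian semigroup need not have; here the product starts from
  the value at an element of \<open>A\<close>. By commutativity the choice of this element is irrelevant.
\<close>

definition semigroup_prod :: "('g, 'm) monoid_scheme \<Rightarrow> ('b \<Rightarrow> 'g) \<Rightarrow> 'b set \<Rightarrow> 'g"
  where "semigroup_prod G f A =
    (let a = (SOME a. a \<in> A) in foldD (carrier G) (\<lambda>b x. f b \<otimes>\<^bsub>G\<^esub> x) (f a) (A - {a}))"

text \<open>
  The component of the stacked diagram that gives rise to a block \<open>C\<close> of the product, and the
  two-element blocks of each factor that contribute to \<open>C\<close>.
\<close>

definition component_of ::
    "('a + 'a) set set \<Rightarrow> ('a + 'a) set set \<Rightarrow> ('a + 'a) set \<Rightarrow> 'a stacked set"
  where "component_of P Q C = connected_rel P Q `` (outer_rows ` C)"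

definition first_contributing ::
    "('a + 'a) set set \<Rightarrow> ('a + 'a) set set \<Rightarrow> ('a + 'a) set \<Rightarrow> ('a + 'a) set set"
  where "first_contributing P Q C = {B \<in> pair_blocks P. first_rows ` B \<subseteq> component_of P Q C}"

definition last_contributing ::
    "('a + 'a) set set \<Rightarrow> ('a + 'a) set set \<Rightarrow> ('a + 'a) set \<Rightarrow> ('a + 'a) set set"
  where "last_contributing P Q C = {B \<in> pair_blocks Q. last_rows ` B \<subseteq> component_of P Q C}"

text \<open>
  A coloring is extensional, that is \<open>undefined\<close> outside the two-element blocks, so that it is
  determined by its values on them. The disjoint sum \<open><+>\<close> in the product keeps a block of \<open>P\<close>
  apart from an equal block of \<open>Q\<close>.
\<close>

definition APB_mult ::
    "('g, 'm) monoid_scheme \<Rightarrow>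
     ('a + 'a) set set \<times> (('a + 'a) set \<Rightarrow> 'g) \<Rightarrow>
     ('a + 'a) set set \<times> (('a + 'a) set \<Rightarrow> 'g) \<Rightarrow>
     ('a + 'a) set set \<times> (('a + 'a) set \<Rightarrow> 'g)"
  where "APB_mult G = (\<lambda>(P, f) (Q, g).
    (concatenation P Q,
     \<lambda>C \<in> pair_blocks (concatenation P Q).
       semigroup_prod G (case_sum f g) (first_contributing P Q C <+> last_contributing P Q C)))"

definition APB ::
    "nat \<Rightarrow> ('g, 'm) monoid_scheme \<Rightarrow> ((nat + nat) set set \<times> ((nat + nat) set \<Rightarrow> 'g)) monoid"
  where "APB n G =
    \<lparr>carrier = {(P, f). P \<in> partial_brauer_diagrams {1..n} \<and> f \<in> pair_blocks P \<rightarrow>\<^sub>E carrier G},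
     monoid.mult = APB_mult G,
     one = (identity_diagram {1..n}, \<lambda>C \<in> identity_diagram {1..n}. \<one>\<^bsub>G\<^esub>)\<rparr>"

end

theory Submission
  imports Defs
begin

text \<open>
  The isomorphism forgets signs. View a diagram of type B as a double cover of a diagram on
  \<open>{1..n}\<close>, with \<open>x \<mapsto> \<bar>x\<bar>\<close> as the covering map. A block of an invariant diagram is either
  \<open>{x, -x}\<close>, which becomes the singleton \<open>{\<bar>x\<bar>}\<close>, or it differs from its negative, and the two
  blocks \<open>{x, y}\<close> and \<open>{-x, -y}\<close> both become the pair \<open>{\<bar>x\<bar>, \<bar>y\<bar>}\<close>. In the second case the only
  information that is lost is whether \<open>x\<close> and \<open>y\<close> have the same sign, and this is kept as the color,
  an element of \<open>\<int>\<^sub>2\<close>. So a diagram can be recovered from its image, and every colored partial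
  diagram arises: this is \<open>bij_betw_abs_diagram\<close>.

  For multiplicativity, paths in the stacked diagrams of absolute values lift to paths upstairs
  (\<open>connected_rel_lift\<close>). Hence the connected classes downstairs are the images of those upstairs,
  and underlying diagrams multiply correctly (\<open>abs_diagram_concatenation\<close>). For the colors, let \<open>K\<close>
  be the class upstairs of a block of the product whose image has two elements. Then \<open>K\<close> does not
  meet its negative, so forgetting signs is injective on \<open>K\<close> (\<open>inj_on_abs_stacked_class\<close>) and every
  vertex downstairs inherits a definite sign, recorded as a bit. The color of a contributing block is
  the sum of the bits of its two points. In the sum over all contributing blocks a middle vertex
  occurs twice, once in each factor, and an outer vertex occurs once. Modulo 2 there remains the sum
  of the bits of the outer vertices, which is the color of the block of the product
  (\<open>twist_coloring_concatenation\<close>).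

  The monoid laws are proved only for the type B monoid and carried over along the bijection.
  Concatenation of arbitrary partitions is associative because both bracketings describe
  connectivity in the same stack of four rows (\<open>concatenation_assoc\<close>). Brauer diagrams are closed
  under concatenation by an edge count (\<open>concatenation_brauer\<close>): a connected graph has at most one
  vertex more than it has edges, which leaves at most two outer vertices in a class, and their
  number is even since each factor covers its vertices by disjoint pairs.
\<close>

section \<open>Partitions and reachability\<close>

text \<open>
  A partition is handled through its equivalence relation. Relations can be transported along maps
  and combined by union and reflexive transitive closure, which is what stacking diagrams requires.
\<close>

definition same_block :: "'b set set \<Rightarrow> ('b \<times> 'b) set"
  where "same_block P = {(x, y). \<exists>B\<in>P. x \<in> B \<and> y \<in> B}"

lemma partition_eq_if_same_block_eq:
  assumes "partition_on A P" "partition_on A Q" "same_block P = same_block Q"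
  shows "P = Q"
proof -
  have "P = A // same_block P" "Q = A // same_block Q"
    unfolding same_block_def by (simp_all only: partition_on_eq_quotient assms(1,2))
  then show ?thesis using assms(3) by simp
qed

lemma partition_block_unique:
  assumes "partition_on A P" "B \<in> P" "B' \<in> P" "x \<in> B" "x \<in> B'"
  shows "B = B'"
  using assms partition_onD2[OF assms(1)] unfolding disjoint_def by blast

text \<open>
  Every block of \<open>Q\<close> shares a point with a block of \<open>P\<close>, which is also a block of \<open>Q\<close>.
\<close>

lemma partition_eq_if_subset:
  assumes P: "partition_on A P" and Q: "partition_on A Q" and "P \<subseteq> Q"
  shows "P = Q"
proof
  show "Q \<subseteq> P"
  proof
    fix B assume B: "B \<in> Q"
    then obtain x where x: "x \<in> B" using partition_onD3[OF Q] by fastforce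
    then obtain B' where "B' \<in> P" "x \<in> B'"
      using B partition_onD1[OF Q] partition_onD1[OF P] by blast
    then show "B \<in> P"
      using x B \<open>P \<subseteq> Q\<close> partition_block_unique[OF Q] by blast
  qed
qed fact

lemma sym_same_block: "sym (same_block P)"
  by (auto simp: same_block_def sym_def)

lemma same_block_rtrancl:
  assumes "partition_on A P" "(x, y) \<in> (same_block P)\<^sup>*" "x \<in> A"
  shows "(x, y) \<in> same_block P"
proof -
  have "trans (same_block P)"
    using equiv_partition_on[OF assms(1)] by (auto simp: equiv_def same_block_def)
  moreover have "(x, x) \<in> same_block P"
    using assms partition_onD1[OF assms(1)] by (auto simp: same_block_def)
  ultimately show ?thesis
    using assms(2) by (metis rtranclD trancl_id)
qed

lemma sum_blocks_within:
  assumes P: "partition_on A P" and T: "finite T" "T \<subseteq> A"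
    and saturated: "\<And>B. B \<in> P \<Longrightarrow> B \<inter> T \<noteq> {} \<Longrightarrow> B \<subseteq> T"
  shows "(\<Sum>B\<in>{B \<in> P. B \<subseteq> T}. sum g B) = sum g T"
proof -
  have "T = \<Union> {B \<in> P. B \<subseteq> T}"
    using T(2) saturated partition_onD1[OF P] by blast
  moreover have "sum g (\<Union> {B \<in> P. B \<subseteq> T}) = (\<Sum>B\<in>{B \<in> P. B \<subseteq> T}. sum g B)"
    using partition_onD2[OF P] T(1)
    by (subst sum.Union_disjoint) (auto simp: disjoint_def intro: finite_subset)
  ultimately show ?thesis by simp
qed

lemma rtrancl_map_prod_iff:
  assumes "inj h"
  shows "(h x, h y) \<in> (map_prod h h ` R)\<^sup>* \<longleftrightarrow> (x, y) \<in> R\<^sup>*"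
proof
  have "v \<in> range h \<and> (x, the_inv h v) \<in> R\<^sup>*" if "(h x, v) \<in> (map_prod h h ` R)\<^sup>*" for v
    using that
  proof (induction rule: rtrancl_induct)
    case base
    then show ?case using assms by (simp add: the_inv_f_f)
  next
    case (step v w)
    then obtain a b where "v = h a" "w = h b" "(a, b) \<in> R" by auto
    then show ?case using step.IH assms by (auto simp: the_inv_f_f intro: rtrancl_into_rtrancl)
  qed
  then show "(h x, h y) \<in> (map_prod h h ` R)\<^sup>* \<Longrightarrow> (x, y) \<in> R\<^sup>*"
    using assms by (metis the_inv_f_f)
next
  show "(x, y) \<in> R\<^sup>* \<Longrightarrow> (h x, h y) \<in> (map_prod h h ` R)\<^sup>*"
    by (induction rule: rtrancl_induct) (auto intro: rtrancl_into_rtrancl)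
qed

lemma rtrancl_image_subset:
  assumes "(u, v) \<in> R\<^sup>*" "map_prod h h ` R \<subseteq> S\<^sup>*"
  shows "(h u, h v) \<in> S\<^sup>*"
  using assms(1)
proof (induction rule: rtrancl_induct)
  case (step v w)
  then show ?case using assms(2) by (force intro: rtrancl_trans)
qed simp

lemma rtrancl_leaves_set:
  assumes "(u, v) \<in> R\<^sup>*" "u \<in> S" "v \<notin> S"
  shows "\<exists>a b. (a, b) \<in> R \<and> a \<in> S \<and> b \<notin> S"
  using assms by (induction rule: rtrancl_induct) auto

text \<open>
  A path that starts and ends in \<open>S\<close> can leave \<open>S\<close> only through steps of \<open>A\<close>. So it splits into steps
  of \<open>B\<close> and maximal runs of \<open>A\<close> between points of \<open>S\<close>, and each such run is a single step of \<open>A'\<close> or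
  trivial. This is what allows a row of vertices to be eliminated from a stack.
\<close>

lemma rtrancl_restrict_endpoints:
  assumes B: "B \<subseteq> S \<times> S" and A': "A' \<subseteq> A\<^sup>*" "A\<^sup>* \<inter> S \<times> S \<subseteq> A'\<^sup>="
    and S: "u \<in> S" "v \<in> S"
  shows "(u, v) \<in> (A \<union> B)\<^sup>* \<longleftrightarrow> (u, v) \<in> (A' \<union> B)\<^sup>*"
proof
  assume "(u, v) \<in> (A \<union> B)\<^sup>*"
  then have "\<exists>w\<in>S. (u, w) \<in> (A' \<union> B)\<^sup>* \<and> (w, v) \<in> A\<^sup>*"
  proof (induction rule: rtrancl_induct)
    case base
    then show ?case using S by blast
  next
    case (step v z)
    then obtain w where w: "w \<in> S" "(u, w) \<in> (A' \<union> B)\<^sup>*" "(w, v) \<in> A\<^sup>*" by blast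
    show ?case
    proof (cases "(v, z) \<in> A")
      case True
      then show ?thesis using w by (meson rtrancl_into_rtrancl)
    next
      case False
      then have vz: "(v, z) \<in> B" using step.hyps by blast
      then have "(w, v) \<in> A'\<^sup>=" using w B A'(2) by blast
      then have "(u, v) \<in> (A' \<union> B)\<^sup>*" using w(2) by (auto intro: rtrancl_into_rtrancl)
      then have "(u, z) \<in> (A' \<union> B)\<^sup>*" using vz by (auto intro: rtrancl_into_rtrancl)
      then show ?thesis using vz B by blast
    qed
  qed
  then obtain w where "w \<in> S" "(u, w) \<in> (A' \<union> B)\<^sup>*" "(w, v) \<in> A\<^sup>*" by blast
  moreover from this have "(w, v) \<in> A'\<^sup>=" using S A'(2) by blast
  ultimately show "(u, v) \<in> (A' \<union> B)\<^sup>*" by (auto intro: rtrancl_into_rtrancl)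
next
  have "A' \<union> B \<subseteq> (A \<union> B)\<^sup>*"
    using A'(1) rtrancl_mono[of A "A \<union> B"] by auto
  then have "(A' \<union> B)\<^sup>* \<subseteq> (A \<union> B)\<^sup>*" by (rule rtrancl_subset_rtrancl)
  then show "(u, v) \<in> (A' \<union> B)\<^sup>* \<Longrightarrow> (u, v) \<in> (A \<union> B)\<^sup>*" by blast
qed

section \<open>Connected classes of stacked diagrams\<close>

lemma rows_simps [simp]:
  "first_rows (Inl i) = Top i" "first_rows (Inr i) = Middle i"
  "last_rows (Inl i) = Middle i" "last_rows (Inr i) = Bottom i"
  "outer_rows (Inl i) = Top i" "outer_rows (Inr i) = Bottom i"
  by (simp_all add: first_rows_def last_rows_def outer_rows_def)

lemma inj_rows: "inj first_rows" "inj last_rows" "inj outer_rows"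
  by (auto simp: inj_def first_rows_def last_rows_def outer_rows_def split: sum.splits)

lemma connected_rel_eq: "connected_rel P Q = (same_block (stacked_blocks P Q))\<^sup>*"
  by (simp add: connected_rel_def same_block_def)

lemma same_block_stacked_blocks:
  "same_block (stacked_blocks P Q) =
    map_prod first_rows first_rows ` same_block P \<union> map_prod last_rows last_rows ` same_block Q"
  unfolding same_block_def stacked_blocks_def by (auto simp: image_iff; blast)

lemma equiv_connected_rel: "equiv UNIV (connected_rel P Q)"
  unfolding connected_rel_eq
  by (intro equivI refl_rtrancl sym_rtrancl sym_same_block trans_rtrancl) auto

lemma connected_rel_sym: "(u, v) \<in> connected_rel P Q \<Longrightarrow> (v, u) \<in> connected_rel P Q"
  using equiv_connected_rel by (metis equivE symD)

lemma connected_rel_trans: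
  "(u, v) \<in> connected_rel P Q \<Longrightarrow> (v, w) \<in> connected_rel P Q \<Longrightarrow> (u, w) \<in> connected_rel P Q"
  unfolding connected_rel_eq by (rule rtrancl_trans)

lemma connected_rel_refl: "(u, u) \<in> connected_rel P Q"
  unfolding connected_rel_eq by simp

lemma Union_stacked_blocks:
  assumes "partition_on (V <+> V) P" "partition_on (V <+> V) Q"
  shows "\<Union> (stacked_blocks P Q) = Top ` V \<union> Middle ` V \<union> Bottom ` V"
proof -
  have "\<Union> (stacked_blocks P Q) = first_rows ` \<Union> P \<union> last_rows ` \<Union> Q"
    unfolding stacked_blocks_def by blast
  also have "\<dots> = first_rows ` (V <+> V) \<union> last_rows ` (V <+> V)"
    using assms by (simp add: partition_on_def)
  also have "\<dots> = Top ` V \<union> Middle ` V \<union> Bottom ` V"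
    by (auto simp: Plus_def image_Un image_image)
  finally show ?thesis .
qed

lemma connected_rel_Field:
  assumes "(u, v) \<in> connected_rel P Q" "u \<in> \<Union> (stacked_blocks P Q)"
  shows "v \<in> \<Union> (stacked_blocks P Q)"
  using assms unfolding connected_rel_eq
  by (induction rule: rtrancl_induct) (auto simp: same_block_def)

lemma outer_rows_in_Union:
  assumes "partition_on (V <+> V) P" "partition_on (V <+> V) Q"
  shows "outer_rows x \<in> \<Union> (stacked_blocks P Q) \<longleftrightarrow> x \<in> V <+> V"
  unfolding Union_stacked_blocks[OF assms] by (cases x) auto

text \<open>
  A component has a nonempty trace on the outer rows exactly if it is the class of an outer vertex.
\<close>

lemma concatenation_eq:
  assumes "partition_on (V <+> V) P" "partition_on (V <+> V) Q"
  shows "concatenation P Q =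
    (\<lambda>x. outer_rows -` (connected_rel P Q `` {outer_rows x})) ` (V <+> V)"
proof (intro Set.set_eqI iffI)
  fix C assume "C \<in> concatenation P Q"
  then obtain u where u: "u \<in> \<Union> (stacked_blocks P Q)"
    and C: "C = outer_rows -` (connected_rel P Q `` {u})" and ne: "C \<noteq> {}"
    by (auto simp: concatenation_def components_def quotient_def)
  then obtain x where x: "(u, outer_rows x) \<in> connected_rel P Q" by auto
  then have "connected_rel P Q `` {u} = connected_rel P Q `` {outer_rows x}"
    using equiv_class_eq[OF equiv_connected_rel] by blast
  moreover have "x \<in> V <+> V"
    using connected_rel_Field[OF x u] outer_rows_in_Union[OF assms] by blast
  ultimately show "C \<in> (\<lambda>x. outer_rows -` (connected_rel P Q `` {outer_rows x})) ` (V <+> V)"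
    using C by blast
next
  fix C assume "C \<in> (\<lambda>x. outer_rows -` (connected_rel P Q `` {outer_rows x})) ` (V <+> V)"
  then obtain x where x: "x \<in> V <+> V"
    and C: "C = outer_rows -` (connected_rel P Q `` {outer_rows x})" by blast
  have "x \<in> C" using C by (simp add: connected_rel_refl)
  moreover have "outer_rows x \<in> \<Union> (stacked_blocks P Q)"
    using outer_rows_in_Union[OF assms] x by blast
  ultimately show "C \<in> concatenation P Q"
    unfolding concatenation_def components_def quotient_def using C by blast
qed

lemma partition_on_concatenation:
  assumes "partition_on (V <+> V) P" "partition_on (V <+> V) Q"
  shows "partition_on (V <+> V) (concatenation P Q)"
proof (rule partition_onI)
  show "\<Union> (concatenation P Q) = V <+> V"
  proof (intro equalityI subsetI)
    fix y assume "y \<in> \<Union> (concatenation P Q)"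
    then obtain x where "x \<in> V <+> V" "(outer_rows x, outer_rows y) \<in> connected_rel P Q"
      unfolding concatenation_eq[OF assms] by auto
    then show "y \<in> V <+> V"
      using connected_rel_Field outer_rows_in_Union[OF assms] by blast
  next
    fix y assume "y \<in> V <+> V"
    then show "y \<in> \<Union> (concatenation P Q)"
      unfolding concatenation_eq[OF assms] using connected_rel_refl by fast
  qed
next
  fix C D assume "C \<in> concatenation P Q" "D \<in> concatenation P Q" and ne: "C \<noteq> D"
  then obtain x y where
    C: "C = outer_rows -` (connected_rel P Q `` {outer_rows x})" and
    D: "D = outer_rows -` (connected_rel P Q `` {outer_rows y})"
    unfolding concatenation_eq[OF assms] by blast
  show "disjnt C D"
  proof (rule ccontr)
    assume "\<not> disjnt C D"
    then obtain z where "(outer_rows x, outer_rows z) \<in> connected_rel P Q"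
        "(outer_rows y, outer_rows z) \<in> connected_rel P Q"
      unfolding C D disjnt_def by auto
    then have "(outer_rows x, outer_rows y) \<in> connected_rel P Q"
      by (meson connected_rel_sym connected_rel_trans)
    then show False
      using ne equiv_class_eq[OF equiv_connected_rel] unfolding C D by metis
  qed
next
  show "{} \<notin> concatenation P Q" by (simp add: concatenation_def)
qed

lemma same_block_concatenation:
  assumes "partition_on (V <+> V) P" "partition_on (V <+> V) Q"
  shows "(x, y) \<in> same_block (concatenation P Q) \<longleftrightarrow>
    x \<in> V <+> V \<and> y \<in> V <+> V \<and> (outer_rows x, outer_rows y) \<in> connected_rel P Q"
proof
  assume "(x, y) \<in> same_block (concatenation P Q)"
  then obtain C where C: "C \<in> concatenation P Q" "x \<in> C" "y \<in> C"
    by (auto simp: same_block_def)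
  then have "x \<in> V <+> V" "y \<in> V <+> V"
    using partition_onD1[OF partition_on_concatenation[OF assms]] by blast+
  moreover obtain z where "(outer_rows z, outer_rows x) \<in> connected_rel P Q"
      "(outer_rows z, outer_rows y) \<in> connected_rel P Q"
    using C unfolding concatenation_eq[OF assms] by auto
  ultimately show "x \<in> V <+> V \<and> y \<in> V <+> V \<and> (outer_rows x, outer_rows y) \<in> connected_rel P Q"
    by (meson connected_rel_sym connected_rel_trans)
next
  assume "x \<in> V <+> V \<and> y \<in> V <+> V \<and> (outer_rows x, outer_rows y) \<in> connected_rel P Q"
  then show "(x, y) \<in> same_block (concatenation P Q)"
    unfolding concatenation_eq[OF assms] same_block_def
    by (auto intro!: bexI[of _ x] simp: connected_rel_refl)
qed

section \<open>Associativity and units for concatenation\<close>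

text \<open>
  For associativity three diagrams are stacked, which takes four rows of vertices. The rows are
  numbered, and a diagram is drawn between any two of them.
\<close>

definition place :: "nat \<Rightarrow> nat \<Rightarrow> 'a + 'a \<Rightarrow> nat \<times> 'a"
  where "place i j = case_sum (Pair i) (Pair j)"

definition placed_edges :: "nat \<Rightarrow> nat \<Rightarrow> ('a + 'a) set set \<Rightarrow> ((nat \<times> 'a) \<times> (nat \<times> 'a)) set"
  where "placed_edges i j P = map_prod (place i j) (place i j) ` same_block P"

lemma connected_rel_placed:
  fixes P Q :: "('a + 'a) set set"
  assumes "distinct [i, j, k]"
  shows "(place i k x, place i k y) \<in> (placed_edges i j P \<union> placed_edges j k Q)\<^sup>* \<longleftrightarrow>
    (outer_rows x, outer_rows y) \<in> connected_rel P Q"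
proof -
  define h where "h = case_stacked (Pair i) (Pair j) (Pair k :: 'a \<Rightarrow> nat \<times> 'a)"
  have inj: "inj h" using assms by (auto simp: inj_def h_def split: stacked.splits)
  have *: "h \<circ> first_rows = place i j" "h \<circ> last_rows = place j k" "h \<circ> outer_rows = place i k"
    by (auto simp: h_def place_def fun_eq_iff split: sum.splits)
  have "map_prod h h ` same_block (stacked_blocks P Q) = placed_edges i j P \<union> placed_edges j k Q"
    unfolding same_block_stacked_blocks image_Un image_image placed_edges_def
    by (simp add: map_prod.compositionality * del: map_prod_simp cong: image_cong)
  moreover have "h (outer_rows x) = place i k x" "h (outer_rows y) = place i k y"
    using *(3) by (auto simp: fun_eq_iff)
  ultimately show ?thesis
    using rtrancl_map_prod_iff[OF inj, of "outer_rows x" "outer_rows y"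
        "same_block (stacked_blocks P Q)"]
    by (simp add: connected_rel_eq)
qed

text \<open>
  A path through row \<open>j\<close> enters and leaves it along edges of \<open>P\<close> and \<open>Q\<close>, because \<open>E\<close> does not touch
  that row. So it consists of edges of \<open>E\<close> and of runs between the rows \<open>i\<close> and \<open>k\<close>, and these runs
  are what the product of \<open>P\<close> and \<open>Q\<close> records. Hence the product replaces the stack of \<open>P\<close> and \<open>Q\<close>
  inside any larger diagram.
\<close>

lemma middle_row_hidden:
  assumes P: "partition_on (V <+> V) P" and Q: "partition_on (V <+> V) Q"
    and ijk: "distinct [i, j, k]"
    and E: "E \<subseteq> {u. fst u \<noteq> j} \<times> {u. fst u \<noteq> j}" and uv: "fst u \<noteq> j" "fst v \<noteq> j"
  shows "(u, v) \<in> (placed_edges i j P \<union> placed_edges j k Q \<union> E)\<^sup>* \<longleftrightarrow>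
    (u, v) \<in> (placed_edges i k (concatenation P Q) \<union> E)\<^sup>*"
proof (rule rtrancl_restrict_endpoints[OF E])
  let ?A = "placed_edges i j P \<union> placed_edges j k Q"
  show "placed_edges i k (concatenation P Q) \<subseteq> ?A\<^sup>*"
  proof
    fix e assume "e \<in> placed_edges i k (concatenation P Q)"
    then obtain x y where "e = (place i k x, place i k y)" "(x, y) \<in> same_block (concatenation P Q)"
      unfolding placed_edges_def by auto
    then show "e \<in> ?A\<^sup>*"
      using same_block_concatenation[OF P Q] connected_rel_placed[OF ijk] by metis
  qed
  have field: "\<exists>x\<in>V <+> V. a = place i k x"
    if "a \<in> Field ?A" "fst a \<noteq> j" for a
  proof -
    have "\<exists>y\<in>V <+> V. a = place i j y \<or> a = place j k y"
      using that(1) partition_onD1[OF P] partition_onD1[OF Q]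
      unfolding placed_edges_def Field_def same_block_def by fastforce
    then obtain y where y: "y \<in> V <+> V" "a = place i j y \<or> a = place j k y" by blast
    have "a = place i k y"
      using y(2) that(2) ijk by (cases y) (auto simp: place_def)
    then show ?thesis using y(1) by blast
  qed
  show "?A\<^sup>* \<inter> {u. fst u \<noteq> j} \<times> {u. fst u \<noteq> j} \<subseteq> (placed_edges i k (concatenation P Q))\<^sup>="
  proof clarsimp
    fix r a s b
    assume *: "((r, a), (s, b)) \<in> ?A\<^sup>*" "r \<noteq> j" "s \<noteq> j"
      and "((r, a), (s, b)) \<notin> placed_edges i k (concatenation P Q)"
    show "r = s \<and> a = b"
    proof (rule ccontr)
      assume "\<not> (r = s \<and> a = b)"
      then have "((r, a), (s, b)) \<in> ?A\<^sup>+" using *(1) by (auto dest: rtranclD)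
      then have "(r, a) \<in> Field ?A" "(s, b) \<in> Field ?A"
        by (metis FieldI1 FieldI2 trancl_domain trancl_range Domain.DomainI Range.RangeI
            Field_def UnI1 UnI2)+
      then obtain x y where xy: "x \<in> V <+> V" "y \<in> V <+> V"
        "(r, a) = place i k x" "(s, b) = place i k y"
        using field *(2,3) by (metis fst_conv)
      then have "(x, y) \<in> same_block (concatenation P Q)"
        using *(1) same_block_concatenation[OF P Q] connected_rel_placed[OF ijk] by metis
      then show False
        using xy \<open>((r, a), (s, b)) \<notin> placed_edges i k (concatenation P Q)\<close>
        unfolding placed_edges_def by auto
    qed
  qed
qed (use uv in auto)

text \<open>
  Eliminating row 1 from the stack of \<open>P\<close>, \<open>Q\<close>, \<open>R\<close> on the rows 0, 1, 2, 3 gives the left-hand side,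
  eliminating row 2 gives the right-hand side.
\<close>

lemma concatenation_assoc:
  assumes P: "partition_on (V <+> V) P" and Q: "partition_on (V <+> V) Q"
    and R: "partition_on (V <+> V) R"
  shows "concatenation (concatenation P Q) R = concatenation P (concatenation Q R)"
proof (rule partition_eq_if_same_block_eq)
  note PQ = partition_on_concatenation[OF P Q] and QR = partition_on_concatenation[OF Q R]
  show "partition_on (V <+> V) (concatenation (concatenation P Q) R)"
    "partition_on (V <+> V) (concatenation P (concatenation Q R))"
    by (intro partition_on_concatenation P Q R)+
  have rows: "placed_edges i j D \<subseteq> {u. fst u \<noteq> k} \<times> {u. fst u \<noteq> k}"
    if "k \<noteq> i" "k \<noteq> j" for i j k :: nat and D :: "('a + 'a) set set"
    using that by (auto simp: placed_edges_def place_def split: sum.splits)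
  have ends: "fst (place i j x) \<noteq> k" if "k \<noteq> i" "k \<noteq> j" for i j k :: nat and x :: "'a + 'a"
    using that by (auto simp: place_def split: sum.splits)
  have "(place 0 3 x, place 0 3 y) \<in>
        (placed_edges 0 2 (concatenation P Q) \<union> placed_edges 2 3 R)\<^sup>* \<longleftrightarrow>
      (place 0 3 x, place 0 3 y) \<in>
        (placed_edges 0 1 P \<union> placed_edges 1 2 Q \<union> placed_edges 2 3 R)\<^sup>*" for x y
    by (rule middle_row_hidden[OF P Q, symmetric]) (simp_all add: rows ends)
  moreover have "(place 0 3 x, place 0 3 y) \<in>
        (placed_edges 1 2 Q \<union> placed_edges 2 3 R \<union> placed_edges 0 1 P)\<^sup>* \<longleftrightarrow>
      (place 0 3 x, place 0 3 y) \<in>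
        (placed_edges 1 3 (concatenation Q R) \<union> placed_edges 0 1 P)\<^sup>*" for x y
    by (rule middle_row_hidden[OF Q R]) (simp_all add: rows ends)
  ultimately have
    "(place 0 3 x, place 0 3 y) \<in>
        (placed_edges 0 2 (concatenation P Q) \<union> placed_edges 2 3 R)\<^sup>* \<longleftrightarrow>
      (place 0 3 x, place 0 3 y) \<in>
        (placed_edges 0 1 P \<union> placed_edges 1 3 (concatenation Q R))\<^sup>*" for x y
    by (simp add: Un_ac)
  then have "(outer_rows x, outer_rows y) \<in> connected_rel (concatenation P Q) R \<longleftrightarrow>
      (outer_rows x, outer_rows y) \<in> connected_rel P (concatenation Q R)" for x y
    by (simp add: connected_rel_placed)
  then show "same_block (concatenation (concatenation P Q) R) =
      same_block (concatenation P (concatenation Q R))"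
    by (auto simp: same_block_concatenation[OF PQ R] same_block_concatenation[OF P QR])
qed

lemma partition_on_identity_diagram: "partition_on (V <+> V) (identity_diagram V)"
  by (rule partition_onI) (auto simp: identity_diagram_def disjnt_def)

lemma same_block_identity_diagram:
  "same_block (identity_diagram V) = (\<Union>i\<in>V. {Inl i, Inr i} \<times> {Inl i, Inr i})"
  by (auto simp: same_block_def identity_diagram_def)

text \<open>
  Identifying each top vertex with the middle vertex below it maps the stack onto \<open>P\<close>, so that nothing
  becomes connected that is not already connected in \<open>P\<close>.
\<close>

lemma concatenation_identity_left:
  assumes P: "partition_on (V <+> V) P"
  shows "concatenation (identity_diagram V) P = P"
proof (rule partition_eq_if_same_block_eq[OF partition_on_concatenation P])
  let ?I = "identity_diagram V"
  note I = partition_on_identity_diagram[of V]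
  show "partition_on (V <+> V) (identity_diagram V)" "partition_on (V <+> V) P"
    by (fact I P)+
  define h where "h = case_stacked Inl Inl (Inr :: 'a \<Rightarrow> 'a + 'a)"
  have h_outer: "h (outer_rows x) = x" for x
    by (cases x) (auto simp: h_def)
  have h_last: "h (last_rows x) = x" for x
    by (cases x) (auto simp: h_def)
  have "map_prod h h ` same_block (stacked_blocks ?I P) \<subseteq> (same_block P)\<^sup>*"
    unfolding same_block_stacked_blocks same_block_identity_diagram
    by (auto simp: h_last) (auto simp: h_def)
  then have down: "(x, y) \<in> (same_block P)\<^sup>*"
    if "(outer_rows x, outer_rows y) \<in> connected_rel ?I P" for x y
    using rtrancl_image_subset that unfolding connected_rel_eq by (metis h_outer)
  have link: "(outer_rows x, last_rows x) \<in> connected_rel ?I P" if "x \<in> V <+> V" for x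
    using that unfolding connected_rel_eq same_block_stacked_blocks same_block_identity_diagram
    by (cases x) (auto intro!: r_into_rtrancl simp: image_iff split_paired_all)
  have up: "(outer_rows x, outer_rows y) \<in> connected_rel ?I P"
    if "(x, y) \<in> same_block P" "x \<in> V <+> V" "y \<in> V <+> V" for x y
  proof -
    have "(last_rows x, last_rows y) \<in> connected_rel ?I P"
      using that(1) unfolding connected_rel_eq same_block_stacked_blocks by auto
    then show ?thesis
      using link that(2,3) by (meson connected_rel_sym connected_rel_trans)
  qed
  have "x \<in> V <+> V \<and> y \<in> V <+> V" if "(x, y) \<in> same_block P" for x y
    using that partition_onD1[OF P] by (auto simp: same_block_def)
  then show "same_block (concatenation ?I P) = same_block P"
    using same_block_rtrancl[OF P] up down
    by (auto simp: same_block_concatenation[OF I P])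
qed

text \<open>
  As before, with each bottom vertex identified with the middle vertex above it.
\<close>

lemma concatenation_identity_right:
  assumes P: "partition_on (V <+> V) P"
  shows "concatenation P (identity_diagram V) = P"
proof (rule partition_eq_if_same_block_eq[OF partition_on_concatenation P])
  let ?I = "identity_diagram V"
  note I = partition_on_identity_diagram[of V]
  show "partition_on (V <+> V) P" "partition_on (V <+> V) (identity_diagram V)"
    by (fact I P)+
  define h where "h = case_stacked Inl Inr (Inr :: 'a \<Rightarrow> 'a + 'a)"
  have h_outer: "h (outer_rows x) = x" for x
    by (cases x) (auto simp: h_def)
  have h_first: "h (first_rows x) = x" for x
    by (cases x) (auto simp: h_def)
  have "map_prod h h ` same_block (stacked_blocks P ?I) \<subseteq> (same_block P)\<^sup>*"
    unfolding same_block_stacked_blocks same_block_identity_diagram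
    by (auto simp: h_first) (auto simp: h_def)
  then have down: "(x, y) \<in> (same_block P)\<^sup>*"
    if "(outer_rows x, outer_rows y) \<in> connected_rel P ?I" for x y
    using rtrancl_image_subset that unfolding connected_rel_eq by (metis h_outer)
  have link: "(outer_rows x, first_rows x) \<in> connected_rel P ?I" if "x \<in> V <+> V" for x
    using that unfolding connected_rel_eq same_block_stacked_blocks same_block_identity_diagram
    by (cases x) (auto intro!: r_into_rtrancl simp: image_iff split_paired_all)
  have up: "(outer_rows x, outer_rows y) \<in> connected_rel P ?I"
    if "(x, y) \<in> same_block P" "x \<in> V <+> V" "y \<in> V <+> V" for x y
  proof -
    have "(first_rows x, first_rows y) \<in> connected_rel P ?I"
      using that(1) unfolding connected_rel_eq same_block_stacked_blocks by auto
    then show ?thesis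
      using link that(2,3) by (meson connected_rel_sym connected_rel_trans)
  qed
  have "x \<in> V <+> V \<and> y \<in> V <+> V" if "(x, y) \<in> same_block P" for x y
    using that partition_onD1[OF P] by (auto simp: same_block_def)
  then show "same_block (concatenation P ?I) = same_block P"
    using same_block_rtrancl[OF P] up down
    by (auto simp: same_block_concatenation[OF P I])
qed

section \<open>Concatenation of Brauer diagrams\<close>

lemma sum_sum_type:
  assumes "finite S"
  shows "sum g S = (\<Sum>i\<in>Inl -` S. g (Inl i)) + (\<Sum>i\<in>Inr -` S. g (Inr i))"
proof -
  have "S = Inl -` S <+> Inr -` S"
  proof (rule Set.set_eqI)
    fix x show "x \<in> S \<longleftrightarrow> x \<in> Inl -` S <+> Inr -` S" by (cases x) auto
  qed
  moreover have "finite (Inl -` S)" "finite (Inr -` S)"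
    using assms by (auto intro: finite_vimageI)
  ultimately show ?thesis
    using sum.Plus[of "Inl -` S" "Inr -` S" g] by (simp add: comp_def)
qed

text \<open>
  The first and the last diagram share the middle row, so its vertices are counted twice. Used with
  constant weight 1 to count vertices, and with sign bits to compute colors.
\<close>

lemma sum_over_rows:
  fixes h :: "'a \<Rightarrow> 'b::comm_semiring_1"
  assumes "finite K"
  shows "sum (case_sum h h) (first_rows -` K) + sum (case_sum h h) (last_rows -` K) =
    sum (case_sum h h) (outer_rows -` K) + 2 * (\<Sum>i\<in>Middle -` K. h i)"
proof -
  have "finite (first_rows -` K)" "finite (last_rows -` K)" "finite (outer_rows -` K)"
    using assms by (auto intro: finite_vimageI inj_rows)
  then show ?thesis
    by (simp add: sum_sum_type vimage_def algebra_simps mult_2)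
qed

lemma connected_rel_first_blocks:
  assumes "B \<in> P" "B \<inter> first_rows -` (connected_rel P Q `` {u}) \<noteq> {}"
  shows "B \<subseteq> first_rows -` (connected_rel P Q `` {u})"
proof
  fix b assume b: "b \<in> B"
  obtain a where a: "a \<in> B" "(u, first_rows a) \<in> connected_rel P Q" using assms(2) by auto
  have "(first_rows a, first_rows b) \<in> connected_rel P Q"
    using assms(1) a(1) b unfolding connected_rel_eq same_block_stacked_blocks
    by (force simp: same_block_def)
  then show "b \<in> first_rows -` (connected_rel P Q `` {u})"
    using a(2) connected_rel_trans by auto
qed

lemma connected_rel_last_blocks:
  assumes "B \<in> Q" "B \<inter> last_rows -` (connected_rel P Q `` {u}) \<noteq> {}"
  shows "B \<subseteq> last_rows -` (connected_rel P Q `` {u})"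
proof
  fix b assume b: "b \<in> B"
  obtain a where a: "a \<in> B" "(u, last_rows a) \<in> connected_rel P Q" using assms(2) by auto
  have "(last_rows a, last_rows b) \<in> connected_rel P Q"
    using assms(1) a(1) b unfolding connected_rel_eq same_block_stacked_blocks
    by (force simp: same_block_def)
  then show "b \<in> last_rows -` (connected_rel P Q `` {u})"
    using a(2) connected_rel_trans by auto
qed

lemma connected_class_rows:
  assumes "partition_on (V <+> V) P" "partition_on (V <+> V) Q" "x \<in> V <+> V"
  shows "connected_rel P Q `` {outer_rows x} \<subseteq> Top ` V \<union> Middle ` V \<union> Bottom ` V"
    and "first_rows -` (connected_rel P Q `` {outer_rows x}) \<subseteq> V <+> V"
    and "last_rows -` (connected_rel P Q `` {outer_rows x}) \<subseteq> V <+> V"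
proof -
  let ?K = "connected_rel P Q `` {outer_rows x}"
  show K: "?K \<subseteq> Top ` V \<union> Middle ` V \<union> Bottom ` V"
    using connected_rel_Field outer_rows_in_Union[OF assms(1,2)] assms(3)
    unfolding Union_stacked_blocks[OF assms(1,2), symmetric] by blast
  have "y \<in> V <+> V" if "first_rows y \<in> ?K" for y
    using subsetD[OF K that] by (cases y) auto
  moreover have "y \<in> V <+> V" if "last_rows y \<in> ?K" for y
    using subsetD[OF K that] by (cases y) auto
  ultimately show "first_rows -` ?K \<subseteq> V <+> V" "last_rows -` ?K \<subseteq> V <+> V" by blast+
qed

lemma sum_blocks_in_class:
  fixes h :: "'a \<Rightarrow> 'b::comm_semiring_1"
  assumes PQ: "partition_on (V <+> V) P" "partition_on (V <+> V) Q" and fin: "finite V"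
    and x: "x \<in> V <+> V"
  defines "K \<equiv> connected_rel P Q `` {outer_rows x}"
  shows "(\<Sum>B\<in>{B \<in> P. B \<subseteq> first_rows -` K}. sum (case_sum h h) B) +
      (\<Sum>B\<in>{B \<in> Q. B \<subseteq> last_rows -` K}. sum (case_sum h h) B) =
    sum (case_sum h h) (outer_rows -` K) + 2 * (\<Sum>i\<in>Middle -` K. h i)"
proof -
  note K = connected_class_rows[OF PQ x, folded K_def]
  note sat = connected_rel_first_blocks[of _ P Q "outer_rows x", folded K_def]
    connected_rel_last_blocks[of _ Q P "outer_rows x", folded K_def]
  have "finite K" using K(1) fin by (auto intro: finite_subset)
  moreover have "finite (first_rows -` K)" "finite (last_rows -` K)"
    using \<open>finite K\<close> by (auto intro: finite_vimageI inj_rows)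
  moreover have "(\<Sum>B\<in>{B \<in> P. B \<subseteq> first_rows -` K}. sum (case_sum h h) B) =
      sum (case_sum h h) (first_rows -` K)"
    by (rule sum_blocks_within[OF PQ(1) _ K(2) sat(1)]) (use calculation in auto)
  moreover have "(\<Sum>B\<in>{B \<in> Q. B \<subseteq> last_rows -` K}. sum (case_sum h h) B) =
      sum (case_sum h h) (last_rows -` K)"
    by (rule sum_blocks_within[OF PQ(2) _ K(3) sat(2)]) (use calculation in auto)
  ultimately show ?thesis using sum_over_rows[of K h] by simp
qed

text \<open>
  A connected graph has a spanning tree. The tree is grown from \<open>u\<close>: as long as the set \<open>S\<close> of vertices
  reached is not the whole class, some block joins a vertex of \<open>S\<close> to a vertex outside \<open>S\<close>.
\<close>

lemma card_class_le_Suc_card_blocks: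
  fixes u :: 'b and \<B> :: "'b set set"
  assumes blocks: "\<And>B. B \<in> \<B> \<Longrightarrow> card B = 2"
  defines "K \<equiv> (same_block \<B>)\<^sup>* `` {u}"
  assumes fin: "finite K"
  shows "card K \<le> Suc (card {B \<in> \<B>. B \<subseteq> K})"
proof -
  have u: "u \<in> K" by (simp add: K_def)
  have grow: "\<exists>S. u \<in> S \<and> S \<subseteq> K \<and> card S = Suc k \<and> k \<le> card {B \<in> \<B>. B \<subseteq> S}"
    if "Suc k \<le> card K" for k
    using that
  proof (induction k)
    case 0
    then show ?case using u by (intro exI[of _ "{u}"]) auto
  next
    case (Suc k)
    then obtain S where S: "u \<in> S" "S \<subseteq> K" "card S = Suc k" "k \<le> card {B \<in> \<B>. B \<subseteq> S}"
      by auto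
    have finS: "finite S" using S(2) fin finite_subset by blast
    have "S \<noteq> K" using S(3) Suc.prems by auto
    then obtain v where "v \<in> K" "v \<notin> S" using S(2) by blast
    then obtain a b where ab: "(a, b) \<in> same_block \<B>" "a \<in> S" "b \<notin> S"
      using rtrancl_leaves_set[of u v "same_block \<B>" S] S(1) by (auto simp: K_def)
    then obtain E where E: "E \<in> \<B>" "a \<in> E" "b \<in> E" by (auto simp: same_block_def)
    have "E = {a, b}"
    proof -
      obtain c d where "E = {c, d}" using blocks[OF E(1)] by (auto simp: card_2_iff)
      moreover have "a \<noteq> b" using ab(2,3) by blast
      ultimately show ?thesis using E(2,3) by blast
    qed
    have "b \<in> K"
      using ab(1,2) S(2) by (auto simp: K_def intro: rtrancl_into_rtrancl)
    have "insert E {B \<in> \<B>. B \<subseteq> S} \<subseteq> {B \<in> \<B>. B \<subseteq> insert b S}"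
      using E \<open>E = {a, b}\<close> ab(2) by auto
    moreover have "finite {B \<in> \<B>. B \<subseteq> insert b S}"
      by (rule finite_subset[of _ "Pow (insert b S)"]) (use finS in auto)
    moreover have "finite {B \<in> \<B>. B \<subseteq> S}"
      by (rule finite_subset[of _ "Pow S"]) (use finS in auto)
    then have "card (insert E {B \<in> \<B>. B \<subseteq> S}) = Suc (card {B \<in> \<B>. B \<subseteq> S})"
      using \<open>E = {a, b}\<close> ab(3) by simp
    ultimately have "Suc (card {B \<in> \<B>. B \<subseteq> S}) \<le> card {B \<in> \<B>. B \<subseteq> insert b S}"
      by (metis (no_types, lifting) card_mono)
    then have "Suc k \<le> card {B \<in> \<B>. B \<subseteq> insert b S}"
      using S(4) by linarith
    moreover have "card (insert b S) = Suc (Suc k)" using S(3) finS ab(3) by simp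
    ultimately show ?case
      using S(1,2) \<open>b \<in> K\<close> by (intro exI[of _ "insert b S"]) auto
  qed
  have "card K > 0" using u fin card_gt_0_iff by blast
  then obtain k where k: "card K = Suc k" using gr0_conv_Suc by blast
  obtain S where S: "S \<subseteq> K" "card S = Suc k" "k \<le> card {B \<in> \<B>. B \<subseteq> S}"
    using grow[of k] k by auto
  have "S = K" using S(1,2) k card_subset_eq[OF fin] by simp
  then show ?thesis using S k by simp
qed

text \<open>
  Let a class have \<open>c\<close> outer and \<open>m\<close> middle vertices, and let \<open>p\<close> blocks of \<open>P\<close> and \<open>q\<close> blocks of \<open>Q\<close>
  lie in it. Counting incidences gives \<open>2p + 2q = c + 2m\<close>, and connectedness gives
  \<open>c + m \<le> p + q + 1\<close>. Hence \<open>c \<le> 2\<close> and \<open>c\<close> is even.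
\<close>

lemma concatenation_brauer:
  assumes P: "P \<in> brauer_diagrams V" and Q: "Q \<in> brauer_diagrams V" and fin: "finite V"
  shows "concatenation P Q \<in> brauer_diagrams V"
proof -
  have PQ: "partition_on (V <+> V) P" "partition_on (V <+> V) Q"
    and c2: "\<And>B. B \<in> P \<Longrightarrow> card B = 2" "\<And>B. B \<in> Q \<Longrightarrow> card B = 2"
    using P Q by (auto simp: brauer_diagrams_def)
  have "card C = 2" if C_in: "C \<in> concatenation P Q" for C
  proof -
    obtain x where x: "x \<in> V <+> V"
      and C: "C = outer_rows -` (connected_rel P Q `` {outer_rows x})"
      using C_in unfolding concatenation_eq[OF PQ] by blast
    define K where "K = connected_rel P Q `` {outer_rows x}"
    define p where "p = card {B \<in> P. B \<subseteq> first_rows -` K}"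
    define q where "q = card {B \<in> Q. B \<subseteq> last_rows -` K}"
    note Krows = connected_class_rows[OF PQ x, folded K_def]
    have finK: "finite K" using Krows(1) fin by (auto intro: finite_subset)
    have one: "case_sum (\<lambda>_. 1) (\<lambda>_. 1) = (\<lambda>_. 1 :: nat)"
      by (auto simp: fun_eq_iff split: sum.splits)
    have edges: "2 * p + 2 * q = card C + 2 * card (Middle -` K)"
    proof -
      have "(\<Sum>B\<in>{B \<in> P. B \<subseteq> first_rows -` K}. card B) = p * 2"
        using c2(1) by (simp add: p_def)
      moreover have "(\<Sum>B\<in>{B \<in> Q. B \<subseteq> last_rows -` K}. card B) = q * 2"
        using c2(2) by (simp add: q_def)
      ultimately show ?thesis
        using sum_blocks_in_class[OF PQ fin x, of "\<lambda>_. 1 :: nat"]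
        by (simp add: one C K_def)
    qed
    have "K = outer_rows ` C \<union> Middle ` (Middle -` K)"
    proof (rule Set.set_eqI)
      fix w show "w \<in> K \<longleftrightarrow> w \<in> outer_rows ` C \<union> Middle ` (Middle -` K)"
        unfolding C K_def[symmetric]
        by (cases w) (auto simp: image_iff outer_rows_def split: sum.splits)
    qed
    moreover have "outer_rows ` C \<inter> Middle ` (Middle -` K) = {}"
      by (auto simp: outer_rows_def split: sum.splits)
    moreover have "finite C" "finite (Middle -` K)"
      using finK by (auto simp: C K_def inj_def intro!: finite_vimageI inj_rows)
    moreover have "card (outer_rows ` C) = card C"
      by (rule card_image) (use inj_rows(3) inj_on_subset in blast)
    moreover have "card (Middle ` (Middle -` K)) = card (Middle -` K)"
      by (rule card_image) (auto simp: inj_on_def)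
    ultimately have cardK: "card K = card C + card (Middle -` K)"
      by (metis card_Un_disjoint finite_imageI)
    have "card B = 2" if "B \<in> stacked_blocks P Q" for B
      using that c2 inj_rows inj_on_subset card_image unfolding stacked_blocks_def
      by (metis (no_types, lifting) UnE imageE subset_UNIV)
    then have tree: "card K \<le> Suc (card {B \<in> stacked_blocks P Q. B \<subseteq> K})"
      using card_class_le_Suc_card_blocks[of "stacked_blocks P Q" "outer_rows x"] finK
      by (simp add: K_def connected_rel_eq)
    \<comment> \<open>A block of \<open>P\<close> and a block of \<open>Q\<close> may coincide inside the middle row,
    so only an upper bound on the number of edges is available.\<close>
    have "{B \<in> stacked_blocks P Q. B \<subseteq> K} \<subseteq>
        (`) first_rows ` {B \<in> P. B \<subseteq> first_rows -` K} \<union>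
        (`) last_rows ` {B \<in> Q. B \<subseteq> last_rows -` K}"
      unfolding stacked_blocks_def image_subset_iff_subset_vimage[symmetric] by blast
    moreover have "finite P" "finite Q"
      using finite_elements[OF _ PQ(1)] finite_elements[OF _ PQ(2)] fin by auto
    ultimately have "card {B \<in> stacked_blocks P Q. B \<subseteq> K} \<le>
        card ((`) first_rows ` {B \<in> P. B \<subseteq> first_rows -` K} \<union>
          (`) last_rows ` {B \<in> Q. B \<subseteq> last_rows -` K})"
      by (intro card_mono) auto
    also have "\<dots> \<le> p + q"
      unfolding p_def q_def
      using \<open>finite P\<close> \<open>finite Q\<close> by (intro order_trans[OF card_Un_le] add_mono card_image_le) auto
    finally have "card C \<le> 2" using tree edges cardK by linarith
    moreover have "even (card C)" using edges by presburger
    moreover have "card C \<noteq> 0"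
      using \<open>finite C\<close> C_in by (auto simp: concatenation_def)
    ultimately show ?thesis by presburger
  qed
  then show ?thesis
    using partition_on_concatenation[OF PQ] by (simp add: brauer_diagrams_def)
qed

section \<open>The type B Brauer monoid\<close>

abbreviation negate :: "int + int \<Rightarrow> int + int"
  where "negate \<equiv> map_sum uminus uminus"

lemma negate_negate [simp]: "negate (negate x) = x"
  by (cases x) auto

lemma negate_image_negate_image [simp]: "negate ` negate ` B = B"
  by (simp add: image_image)

lemma negate_in_signed_points [simp]:
  "negate x \<in> signed_points n <+> signed_points n \<longleftrightarrow> x \<in> signed_points n <+> signed_points n"
  by (cases x) (auto simp: signed_points_def)

lemma finite_signed_points: "finite (signed_points n)"
  by (simp add: signed_points_def)

lemma negate_image_in_diagram:
  assumes "negate_diagram D = D" "B \<in> D"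
  shows "negate ` B \<in> D"
  using assms unfolding negate_diagram_def by blast

lemma negate_diagram_eqI:
  assumes "\<And>B. B \<in> D \<Longrightarrow> negate ` B \<in> D"
  shows "negate_diagram D = D"
proof
  show "negate_diagram D \<subseteq> D" using assms by (auto simp: negate_diagram_def)
  show "D \<subseteq> negate_diagram D"
  proof
    fix B assume "B \<in> D"
    then have "negate ` (negate ` B) \<in> negate_diagram D"
      using assms unfolding negate_diagram_def by blast
    then show "B \<in> negate_diagram D" by simp
  qed
qed

text \<open>
  Negation of all vertices is an automorphism of the stack of two invariant diagrams, so it maps
  paths to paths.
\<close>

lemma connected_rel_negate:
  assumes D: "negate_diagram D = D" and E: "negate_diagram E = E"
    and "(u, v) \<in> connected_rel D E"
  shows "(map_stacked uminus u, map_stacked uminus v) \<in> connected_rel D E"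
proof -
  have rows: "map_stacked uminus (first_rows x) = first_rows (negate x)"
    "map_stacked uminus (last_rows x) = last_rows (negate x)" for x :: "int + int"
    by (cases x; simp)+
  have neg: "(negate x, negate y) \<in> same_block F"
    if F: "negate_diagram F = F" and xy: "(x, y) \<in> same_block F" for F x y
  proof -
    obtain B where "B \<in> F" "x \<in> B" "y \<in> B" using xy by (auto simp: same_block_def)
    then have "negate ` B \<in> F" "negate x \<in> negate ` B" "negate y \<in> negate ` B"
      using negate_image_in_diagram[OF F] by blast+
    then show ?thesis unfolding same_block_def by blast
  qed
  have "map_prod (map_stacked uminus) (map_stacked uminus) ` same_block (stacked_blocks D E)
      \<subseteq> same_block (stacked_blocks D E)"
    unfolding same_block_stacked_blocks image_Un
    using neg[OF D] neg[OF E] by (intro Un_mono) (force simp: rows)+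
  then have "map_prod (map_stacked uminus) (map_stacked uminus) ` same_block (stacked_blocks D E)
      \<subseteq> (same_block (stacked_blocks D E))\<^sup>*"
    by (rule order_trans) (simp add: r_into_rtrancl subrelI)
  with assms(3) show ?thesis
    unfolding connected_rel_eq by (rule rtrancl_image_subset)
qed

lemma connected_rel_negate_iff:
  assumes "negate_diagram D = D" "negate_diagram E = E"
  shows "(map_stacked uminus u, map_stacked uminus v) \<in> connected_rel D E \<longleftrightarrow>
    (u, v) \<in> connected_rel D E"
proof -
  have "map_stacked uminus (map_stacked uminus w) = w" for w :: "int stacked"
    by (cases w) auto
  then show ?thesis using connected_rel_negate[OF assms] by metis
qed

lemma BrB_memD:
  assumes "D \<in> carrier (BrB n)"
  shows "partition_on (signed_points n <+> signed_points n) D"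
    and "\<And>B. B \<in> D \<Longrightarrow> card B = 2"
    and "negate_diagram D = D"
  using assms by (auto simp: BrB_def brauer_diagrams_def)

lemma concatenation_BrB:
  assumes D: "D \<in> carrier (BrB n)" and E: "E \<in> carrier (BrB n)"
  shows "concatenation D E \<in> carrier (BrB n)"
proof -
  note DE = BrB_memD(1)[OF D] BrB_memD(1)[OF E]
  have "negate ` C \<in> concatenation D E" if C_in: "C \<in> concatenation D E" for C
  proof -
    obtain x where x: "x \<in> signed_points n <+> signed_points n"
      and C: "C = outer_rows -` (connected_rel D E `` {outer_rows x})"
      using C_in unfolding concatenation_eq[OF DE] by blast
    have outer: "outer_rows (negate y) = map_stacked uminus (outer_rows y)" for y
      by (cases y) auto
    have "negate y \<in> C \<longleftrightarrow> (outer_rows (negate x), outer_rows y) \<in> connected_rel D E" for y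
      using connected_rel_negate_iff[OF BrB_memD(3)[OF D] BrB_memD(3)[OF E],
          of "outer_rows x" "outer_rows (negate y)"]
      by (simp add: C outer[symmetric])
    then have "negate ` C = outer_rows -` (connected_rel D E `` {outer_rows (negate x)})"
      by (auto simp: image_iff) (metis negate_negate)+
    then show ?thesis
      unfolding concatenation_eq[OF DE]
      by (rule image_eqI) (simp only: negate_in_signed_points x)
  qed
  then have "negate_diagram (concatenation D E) = concatenation D E"
    by (rule negate_diagram_eqI)
  then show ?thesis
    using D E concatenation_brauer[OF _ _ finite_signed_points] by (simp add: BrB_def)
qed

lemma identity_diagram_BrB: "identity_diagram (signed_points n) \<in> carrier (BrB n)"
proof -
  have "negate ` B \<in> identity_diagram (signed_points n)"
    if "B \<in> identity_diagram (signed_points n)" for B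
    using that by (auto simp: identity_diagram_def signed_points_def image_iff)
  moreover have "card B = 2" if "B \<in> identity_diagram (signed_points n)" for B
    using that by (auto simp: identity_diagram_def)
  ultimately show ?thesis
    by (simp add: BrB_def brauer_diagrams_def partition_on_identity_diagram negate_diagram_eqI)
qed

lemma monoid_BrB: "monoid (BrB n)"
proof (rule monoidI)
  fix D E F assume "D \<in> carrier (BrB n)" "E \<in> carrier (BrB n)" "F \<in> carrier (BrB n)"
  then show "D \<otimes>\<^bsub>BrB n\<^esub> E \<otimes>\<^bsub>BrB n\<^esub> F = D \<otimes>\<^bsub>BrB n\<^esub> (E \<otimes>\<^bsub>BrB n\<^esub> F)"
    using concatenation_assoc BrB_memD(1) by (simp add: BrB_def) blast
next
  fix D E assume "D \<in> carrier (BrB n)" "E \<in> carrier (BrB n)"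
  then show "D \<otimes>\<^bsub>BrB n\<^esub> E \<in> carrier (BrB n)"
    using concatenation_BrB[of D n E] unfolding BrB_def by simp
next
  show "\<one>\<^bsub>BrB n\<^esub> \<in> carrier (BrB n)"
    using identity_diagram_BrB by (simp add: BrB_def)
next
  fix D assume "D \<in> carrier (BrB n)"
  then show "\<one>\<^bsub>BrB n\<^esub> \<otimes>\<^bsub>BrB n\<^esub> D = D" "D \<otimes>\<^bsub>BrB n\<^esub> \<one>\<^bsub>BrB n\<^esub> = D"
    using concatenation_identity_left[OF BrB_memD(1)] concatenation_identity_right[OF BrB_memD(1)]
    by (simp_all add: BrB_def)
qed

section \<open>Forgetting the signs\<close>

definition abs_point :: "int + int \<Rightarrow> nat + nat"
  where "abs_point = map_sum (nat \<circ> abs) (nat \<circ> abs)"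

definition sign_bit :: "int \<Rightarrow> int"
  where "sign_bit i = (if i < 0 then 1 else 0)"

abbreviation point_bit :: "int + int \<Rightarrow> int"
  where "point_bit \<equiv> case_sum sign_bit sign_bit"

text \<open>
  For \<open>B = {x, y}\<close> this is 0 if \<open>x\<close> and \<open>y\<close> have the same sign and 1 otherwise. Writing it as a sum
  of bits makes the colors along a path add up.
\<close>

definition twist :: "(int + int) set \<Rightarrow> int"
  where "twist B = sum point_bit B mod 2"

definition abs_diagram :: "(int + int) set set \<Rightarrow> (nat + nat) set set"
  where "abs_diagram D = (\<lambda>B. abs_point ` B) ` D"

text \<open>
  A pair downstairs is covered by a block and its negative. These have the same twist, so the choice
  between them is irrelevant (see \<open>twist_coloring_apply\<close>).
\<close>

definition twist_coloring :: "(int + int) set set \<Rightarrow> (nat + nat) set \<Rightarrow> int"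
  where "twist_coloring D =
    (\<lambda>C \<in> pair_blocks (abs_diagram D). twist (SOME B. B \<in> D \<and> abs_point ` B = C))"

text \<open>
  The inverse of forgetting signs. A singleton is lifted to the block \<open>{x, -x}\<close> over it, and a pair to
  the two blocks over it whose twist is the prescribed color.
\<close>

definition signed_lift ::
    "nat \<Rightarrow> (nat + nat) set set \<Rightarrow> ((nat + nat) set \<Rightarrow> int) \<Rightarrow> (int + int) set set"
  where "signed_lift n P f =
    {B. B \<subseteq> signed_points n <+> signed_points n \<and> card B = 2 \<and> abs_point ` B \<in> P \<and>
      (card (abs_point ` B) = 2 \<longrightarrow> twist B = f (abs_point ` B))}"

lemma abs_point_eq_iff: "abs_point x = abs_point y \<longleftrightarrow> x = y \<or> x = negate y"
  by (cases x; cases y) (auto simp: abs_point_def nat_eq_iff abs_if split: if_splits)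

lemma abs_point_negate [simp]: "abs_point (negate x) = abs_point x"
  by (simp add: abs_point_eq_iff)

lemma abs_point_image_negate [simp]: "abs_point ` negate ` B = abs_point ` B"
  by (simp add: image_image)

lemma abs_point_mem_iff:
  "abs_point x \<in> {1..n} <+> {1..n} \<longleftrightarrow> x \<in> signed_points n <+> signed_points n"
  by (cases x) (auto simp: abs_point_def signed_points_def)

lemma negate_neq:
  assumes "x \<in> signed_points n <+> signed_points n"
  shows "negate x \<noteq> x"
  using assms by (auto simp: signed_points_def)

lemma point_bit_negate:
  assumes "x \<in> signed_points n <+> signed_points n"
  shows "point_bit (negate x) = 1 - point_bit x"
  using assms by (auto simp: signed_points_def sign_bit_def)

lemma point_bit_cases: "point_bit x = 0 \<or> point_bit x = 1"
  by (cases x) (auto simp: sign_bit_def)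

lemma ex_point_with_bit:
  assumes "c \<in> {1..n} <+> {1..n}" "b \<in> {0, 1}"
  obtains y where "abs_point y = c" "point_bit y = b"
proof -
  have "\<exists>y. abs_point y = c \<and> point_bit y = b"
  proof (cases c)
    case (Inl i)
    then show ?thesis
      using assms by (intro exI[of _ "Inl (if b = 0 then int i else - int i)"])
        (auto simp: abs_point_def sign_bit_def)
  next
    case (Inr i)
    then show ?thesis
      using assms by (intro exI[of _ "Inr (if b = 0 then int i else - int i)"])
        (auto simp: abs_point_def sign_bit_def)
  qed
  then show ?thesis using that by blast
qed

lemma abs_point_image_signed_points:
  "abs_point ` (signed_points n <+> signed_points n) = {1..n} <+> {1..n}"
proof (intro equalityI subsetI)
  fix c assume c: "c \<in> {1..n} <+> {1..n}"
  then obtain y where "abs_point y = c" using ex_point_with_bit by blast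
  then show "c \<in> abs_point ` (signed_points n <+> signed_points n)"
    using c by (intro image_eqI[of _ _ y]) (simp_all flip: abs_point_mem_iff)
next
  fix c assume "c \<in> abs_point ` (signed_points n <+> signed_points n)"
  then show "c \<in> {1..n} <+> {1..n}" by (elim imageE) (simp only: abs_point_mem_iff)
qed

lemma eq_if_abs_point_eq_and_bit_eq:
  assumes "x \<in> signed_points n <+> signed_points n" "abs_point x = abs_point y"
    "point_bit x = point_bit y"
  shows "x = y"
proof (rule ccontr)
  assume "x \<noteq> y"
  then have "y = negate x" using assms(2) by (auto simp: abs_point_eq_iff)
  then have "point_bit x = 1 - point_bit x"
    using assms(3) point_bit_negate[OF assms(1)] by metis
  then show False using point_bit_cases[of x] by linarith
qed

lemma twist_pair: "x \<noteq> y \<Longrightarrow> twist {x, y} = (point_bit x + point_bit y) mod 2"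
  by (simp add: twist_def)

text \<open>
  Negation flips both bits of a pair, and \<open>(1 - a) + (1 - b)\<close> has the parity of \<open>a + b\<close>.
\<close>

lemma twist_negate:
  assumes "B \<subseteq> signed_points n <+> signed_points n" "card B = 2"
  shows "twist (negate ` B) = twist B"
proof -
  obtain x y where B: "B = {x, y}" "x \<noteq> y" using assms(2) by (auto simp: card_2_iff)
  have "negate x \<noteq> negate y" using B(2) by (metis negate_negate)
  then have "twist (negate ` B) = (point_bit (negate x) + point_bit (negate y)) mod 2"
    unfolding B(1) image_insert image_empty by (rule twist_pair)
  also have "\<dots> = ((1 - point_bit x) + (1 - point_bit y)) mod 2"
    using assms(1) B point_bit_negate[of x n] point_bit_negate[of y n] by (simp only: insert_subset)
  also have "\<dots> = twist B"
    using B twist_pair point_bit_cases[of x] point_bit_cases[of y] by fastforce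
  finally show ?thesis .
qed

text \<open>
  Once \<open>x\<close> is known, the image determines the other point of the block up to sign. If the image is a
  singleton, the other point is \<open>-x\<close>; otherwise the twist determines its sign. This gives the
  disjointness of lifted blocks.
\<close>

lemma block_determined:
  assumes B: "B \<subseteq> signed_points n <+> signed_points n" "card B = 2"
    and B': "card B' = 2"
    and x: "x \<in> B" "x \<in> B'"
    and abs: "abs_point ` B = abs_point ` B'"
    and twist: "card (abs_point ` B) = 2 \<Longrightarrow> twist B = twist B'"
  shows "B = B'"
proof -
  obtain y where y: "B = {x, y}" "x \<noteq> y"
    using B(2) x(1) by (auto simp: card_2_iff)
  obtain y' where y': "B' = {x, y'}" "x \<noteq> y'"
    using B' x(2) by (auto simp: card_2_iff)
  have img: "{abs_point x, abs_point y} = {abs_point x, abs_point y'}"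
    using abs y(1) y'(1) by simp
  show ?thesis
  proof (cases "abs_point y = abs_point x")
    case True
    then have "abs_point y' = abs_point x" using img by auto
    then show ?thesis using True y y' by (simp add: abs_point_eq_iff)
  next
    case False
    then have "abs_point y = abs_point y'" using img by auto
    moreover have "twist B = twist B'" using twist False y(1) by simp
    then have "point_bit y = point_bit y'"
      using y y' point_bit_cases[of x] point_bit_cases[of y] point_bit_cases[of y']
      by (auto simp: twist_pair)
    moreover have "y \<in> signed_points n <+> signed_points n" using B(1) y(1) by blast
    ultimately show ?thesis
      using eq_if_abs_point_eq_and_bit_eq y(1) y'(1) by metis
  qed
qed

text \<open>
  If \<open>b'\<close> in \<open>B'\<close> lies over the same point as \<open>b\<close> in \<open>B\<close>, it is \<open>b\<close> or \<open>-b\<close>. So \<open>B'\<close> meets \<open>B\<close> or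
  the negative of \<open>B\<close>, which is also a block.
\<close>

lemma blocks_over_same_point:
  assumes D: "D \<in> carrier (BrB n)" and B: "B \<in> D" "B' \<in> D"
    and meet: "abs_point ` B \<inter> abs_point ` B' \<noteq> {}"
  shows "B' = B \<or> B' = negate ` B"
proof -
  obtain b b' where b: "b \<in> B" "b' \<in> B'" "abs_point b' = abs_point b"
    using meet by (auto simp: image_iff) metis
  have "b' = b \<or> b' = negate b" using b(3) by (simp add: abs_point_eq_iff)
  then have "b' \<in> B \<or> b' \<in> negate ` B" using b(1) by blast
  then show ?thesis
    using partition_block_unique[OF BrB_memD(1)[OF D]] B b(2)
      negate_image_in_diagram[OF BrB_memD(3)[OF D]] by metis
qed

lemma block_subset_signed:
  assumes "D \<in> carrier (BrB n)" "B \<in> D"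
  shows "B \<subseteq> signed_points n <+> signed_points n"
  using partition_onD1[OF BrB_memD(1)[OF assms(1)]] assms(2) by blast

lemma twist_coloring_apply:
  assumes D: "D \<in> carrier (BrB n)" and B: "B \<in> D" "card (abs_point ` B) = 2"
  shows "twist_coloring D (abs_point ` B) = twist B"
proof -
  define B' where "B' = (SOME B'. B' \<in> D \<and> abs_point ` B' = abs_point ` B)"
  have B': "B' \<in> D \<and> abs_point ` B' = abs_point ` B"
    unfolding B'_def by (rule someI[of _ B]) (use B in auto)
  have "abs_point ` B \<inter> abs_point ` B' \<noteq> {}" using B' B(2) by auto
  then have "B' = B \<or> B' = negate ` B" using blocks_over_same_point[OF D] B B' by blast
  then have "twist B' = twist B"
    using twist_negate[OF block_subset_signed[OF D B(1)] BrB_memD(2)[OF D B(1)]] by auto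
  moreover have "twist_coloring D (abs_point ` B) = twist B'"
    using B by (auto simp: twist_coloring_def pair_blocks_def abs_diagram_def B'_def)
  ultimately show ?thesis by simp
qed

lemma abs_diagram_partial_brauer:
  assumes D: "D \<in> carrier (BrB n)"
  shows "abs_diagram D \<in> partial_brauer_diagrams {1..n}"
proof -
  note part = BrB_memD(1)[OF D]
  have "partition_on ({1..n} <+> {1..n}) (abs_diagram D)"
  proof (rule partition_onI)
    have "\<Union> (abs_diagram D) = abs_point ` (signed_points n <+> signed_points n)"
      using partition_onD1[OF part] by (auto simp: abs_diagram_def)
    then show "\<Union> (abs_diagram D) = {1..n} <+> {1..n}"
      by (simp only: abs_point_image_signed_points)
  next
    fix C C' assume "C \<in> abs_diagram D" "C' \<in> abs_diagram D" "C \<noteq> C'"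
    then obtain B B' where B: "B \<in> D" "B' \<in> D" "C = abs_point ` B" "C' = abs_point ` B'"
      by (auto simp: abs_diagram_def)
    then show "disjnt C C'"
      using blocks_over_same_point[OF D B(1,2)] \<open>C \<noteq> C'\<close> abs_point_image_negate
      unfolding disjnt_def by metis
  next
    show "{} \<notin> abs_diagram D"
      using partition_onD3[OF part] by (auto simp: abs_diagram_def)
  qed
  moreover have "card C = 1 \<or> card C = 2" if C_in: "C \<in> abs_diagram D" for C
  proof -
    obtain B where "B \<in> D" "C = abs_point ` B" using C_in by (auto simp: abs_diagram_def)
    moreover from this obtain x y where "B = {x, y}"
      using BrB_memD(2)[OF D] by (metis card_2_iff)
    ultimately have "C = {abs_point x, abs_point y}" by simp
    then show ?thesis by (cases "abs_point x = abs_point y") auto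
  qed
  ultimately show ?thesis by (simp add: partial_brauer_diagrams_def)
qed

lemma partition_on_abs_diagram:
  assumes "D \<in> carrier (BrB n)"
  shows "partition_on ({1..n} <+> {1..n}) (abs_diagram D)"
  using abs_diagram_partial_brauer[OF assms] by (simp add: partial_brauer_diagrams_def)

lemma abs_diagram_in_APB:
  assumes D: "D \<in> carrier (BrB n)"
  shows "(abs_diagram D, twist_coloring D) \<in> carrier (APB n (integer_mod_group 2))"
  using abs_diagram_partial_brauer[OF D]
  by (auto simp: APB_def carrier_integer_mod_group twist_coloring_def twist_def)

lemma APB_memD:
  assumes "(P, f) \<in> carrier (APB n (integer_mod_group 2))"
  shows "partition_on ({1..n} <+> {1..n}) P"
    and "\<And>C. C \<in> P \<Longrightarrow> card C = 1 \<or> card C = 2"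
    and "\<And>C. C \<in> P \<Longrightarrow> card C = 2 \<Longrightarrow> f C \<in> {0, 1}"
    and "\<And>C. C \<notin> pair_blocks P \<Longrightarrow> f C = undefined"
  using assms
  by (auto simp: APB_def partial_brauer_diagrams_def carrier_integer_mod_group pair_blocks_def
      PiE_def Pi_def extensional_def)

text \<open>
  The partner of \<open>x\<close> in the lift is \<open>-x\<close> over a singleton. Over a pair \<open>{\<bar>x\<bar>, c}\<close> it is the point over
  \<open>c\<close> whose sign produces the color.
\<close>

lemma ex_lifted_block:
  assumes Pf: "(P, f) \<in> carrier (APB n (integer_mod_group 2))"
    and x: "x \<in> signed_points n <+> signed_points n"
  shows "\<exists>B \<in> signed_lift n P f. x \<in> B"
proof -
  have "abs_point x \<in> {1..n} <+> {1..n}" using x by (simp only: abs_point_mem_iff)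
  then obtain C where C: "C \<in> P" "abs_point x \<in> C"
    unfolding partition_onD1[OF APB_memD(1)[OF Pf]] by (elim UnionE)
  from APB_memD(2)[OF Pf C(1)] show ?thesis
  proof
    assume "card C = 1"
    then have "C = {abs_point x}" using C(2) by (auto simp: card_1_singleton_iff)
    moreover have "negate x \<noteq> x" using negate_neq[OF x] .
    ultimately have "{x, negate x} \<in> signed_lift n P f"
      using C(1) x negate_in_signed_points[of x n] unfolding signed_lift_def by simp
    then show ?thesis by blast
  next
    assume c2: "card C = 2"
    then obtain c where c: "C = {abs_point x, c}" "c \<noteq> abs_point x"
      using C(2) by (auto simp: card_2_iff)
    have "c \<in> {1..n} <+> {1..n}"
      unfolding partition_onD1[OF APB_memD(1)[OF Pf]] using C(1) c(1) by auto
    moreover have "(point_bit x + f C) mod 2 \<in> {0, 1}" by auto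
    ultimately obtain y where y: "abs_point y = c" "point_bit y = (point_bit x + f C) mod 2"
      using ex_point_with_bit by metis
    have "x \<noteq> y" using y(1) c(2) by blast
    have "y \<in> signed_points n <+> signed_points n"
      using \<open>c \<in> {1..n} <+> {1..n}\<close> by (simp only: abs_point_mem_iff[symmetric] y(1))
    moreover have "twist {x, y} = f C"
      using APB_memD(3)[OF Pf C(1) c2] y(2) point_bit_cases[of x] twist_pair[OF \<open>x \<noteq> y\<close>] by auto
    ultimately have "{x, y} \<in> signed_lift n P f"
      using C(1) c x y(1) \<open>x \<noteq> y\<close> unfolding signed_lift_def by simp
    then show ?thesis by blast
  qed
qed

lemma signed_lift_in_BrB:
  assumes Pf: "(P, f) \<in> carrier (APB n (integer_mod_group 2))"
  shows "signed_lift n P f \<in> carrier (BrB n)"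
proof -
  let ?D = "signed_lift n P f"
  have "partition_on (signed_points n <+> signed_points n) ?D"
  proof (rule partition_onI)
    show "\<Union> ?D = signed_points n <+> signed_points n"
    proof
      show "\<Union> ?D \<subseteq> signed_points n <+> signed_points n" unfolding signed_lift_def by blast
    qed (use ex_lifted_block[OF Pf] in blast)
  next
    fix B B' assume B: "B \<in> ?D" "B' \<in> ?D" "B \<noteq> B'"
    show "disjnt B B'"
    proof (rule ccontr)
      assume "\<not> disjnt B B'"
      then obtain x where x: "x \<in> B" "x \<in> B'" by (auto simp: disjnt_def)
      have "abs_point ` B \<in> P" "abs_point ` B' \<in> P" using B by (auto simp: signed_lift_def)
      then have "abs_point ` B = abs_point ` B'"
        using x partition_block_unique[OF APB_memD(1)[OF Pf]] by blast
      then show False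
        using block_determined[of B n B' x] B x by (simp add: signed_lift_def)
    qed
  next
    show "{} \<notin> ?D" by (simp add: signed_lift_def)
  qed
  moreover have "negate ` B \<in> ?D" if "B \<in> ?D" for B
  proof -
    have "card (negate ` B) = card B"
      by (rule card_image) (metis inj_onI negate_negate)
    moreover have "negate ` B \<subseteq> signed_points n <+> signed_points n"
      using that unfolding signed_lift_def
      by (auto simp only: image_subset_iff negate_in_signed_points subset_iff)
    ultimately show ?thesis
      using that twist_negate[of B n] by (simp add: signed_lift_def)
  qed
  moreover have "card B = 2" if "B \<in> ?D" for B
    using that by (simp add: signed_lift_def)
  ultimately show ?thesis
    by (simp add: BrB_def brauer_diagrams_def negate_diagram_eqI)
qed

lemma abs_diagram_signed_lift:
  assumes Pf: "(P, f) \<in> carrier (APB n (integer_mod_group 2))"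
  shows "abs_diagram (signed_lift n P f) = P"
proof
  show "abs_diagram (signed_lift n P f) \<subseteq> P" by (auto simp: abs_diagram_def signed_lift_def)
  show "P \<subseteq> abs_diagram (signed_lift n P f)"
  proof
    fix C assume C: "C \<in> P"
    then obtain c where c: "c \<in> C" using partition_onD3[OF APB_memD(1)[OF Pf]] by fastforce
    then have cU: "c \<in> {1..n} <+> {1..n}"
      using partition_onD1[OF APB_memD(1)[OF Pf]] C by blast
    then obtain x where x: "abs_point x = c" using ex_point_with_bit by blast
    then obtain B where B: "B \<in> signed_lift n P f" "x \<in> B"
      using ex_lifted_block[OF Pf] abs_point_mem_iff cU by metis
    then have "abs_point ` B \<in> P" "c \<in> abs_point ` B" using x by (auto simp: signed_lift_def)
    then have "C = abs_point ` B"
      using C c partition_block_unique[OF APB_memD(1)[OF Pf]] by blast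
    then show "C \<in> abs_diagram (signed_lift n P f)" using B(1) by (auto simp: abs_diagram_def)
  qed
qed

lemma twist_coloring_signed_lift:
  assumes Pf: "(P, f) \<in> carrier (APB n (integer_mod_group 2))"
  shows "twist_coloring (signed_lift n P f) = f"
proof
  fix C
  show "twist_coloring (signed_lift n P f) C = f C"
  proof (cases "C \<in> pair_blocks P")
    case True
    then have C: "C \<in> abs_diagram (signed_lift n P f)" "card C = 2"
      using abs_diagram_signed_lift[OF Pf] by (auto simp: pair_blocks_def)
    then obtain B where B: "B \<in> signed_lift n P f" "C = abs_point ` B"
      by (auto simp: abs_diagram_def)
    then have "twist_coloring (signed_lift n P f) C = twist B"
      using twist_coloring_apply[OF signed_lift_in_BrB[OF Pf]] C(2) by metis
    also have "\<dots> = f C" using B C(2) by (simp add: signed_lift_def)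
    finally show ?thesis .
  next
    case False
    then show ?thesis
      using APB_memD(4)[OF Pf] abs_diagram_signed_lift[OF Pf] by (simp add: twist_coloring_def)
  qed
qed

lemma signed_lift_abs_diagram:
  assumes D: "D \<in> carrier (BrB n)"
  shows "signed_lift n (abs_diagram D) (twist_coloring D) = D"
proof (rule partition_eq_if_subset[symmetric])
  show "partition_on (signed_points n <+> signed_points n) D"
    "partition_on (signed_points n <+> signed_points n)
      (signed_lift n (abs_diagram D) (twist_coloring D))"
    using BrB_memD(1) D signed_lift_in_BrB[OF abs_diagram_in_APB[OF D]] by blast+
  show "D \<subseteq> signed_lift n (abs_diagram D) (twist_coloring D)"
    using block_subset_signed[OF D] BrB_memD(2)[OF D] twist_coloring_apply[OF D]
    by (auto simp: signed_lift_def abs_diagram_def)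
qed

text \<open>
  The lift recovers a type B diagram \<open>D\<close> because its blocks include those of \<open>D\<close>, and both are
  partitions of the same set. Conversely, the lifted blocks cover every point, so each block
  downstairs is the image of one of them, with the prescribed twist.
\<close>

lemma bij_betw_abs_diagram:
  "bij_betw (\<lambda>D. (abs_diagram D, twist_coloring D)) (carrier (BrB n))
    (carrier (APB n (integer_mod_group 2)))"
proof (rule bij_betw_byWitness[where f' = "\<lambda>(P, f). signed_lift n P f"])
  show "\<forall>D\<in>carrier (BrB n).
      (case (abs_diagram D, twist_coloring D) of (P, f) \<Rightarrow> signed_lift n P f) = D"
    using signed_lift_abs_diagram by simp
  show "\<forall>Pf\<in>carrier (APB n (integer_mod_group 2)).
      (abs_diagram (case Pf of (P, f) \<Rightarrow> signed_lift n P f),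
       twist_coloring (case Pf of (P, f) \<Rightarrow> signed_lift n P f)) = Pf"
    using abs_diagram_signed_lift twist_coloring_signed_lift by auto
qed (use abs_diagram_in_APB signed_lift_in_BrB in auto)

section \<open>Products of colors\<close>

text \<open>
  In a monoid the factor with which the fold starts can be absorbed into the product, so the
  semigroup product agrees with the usual one and becomes a sum modulo \<open>m\<close> in the cyclic groups.
\<close>

lemma (in comm_monoid) semigroup_prod_eq_finprod:
  assumes "finite A" "A \<noteq> {}" and F: "F \<in> A \<rightarrow> carrier G"
  shows "semigroup_prod G F A = finprod G F A"
proof -
  define a where "a = (SOME a. a \<in> A)"
  have a: "a \<in> A" using \<open>A \<noteq> {}\<close> by (simp add: a_def some_in_eq)
  interpret LCD A "carrier G" "\<lambda>b x. F b \<otimes> x"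
    using F by unfold_locales (auto simp: m_lcomm Pi_iff)
  have fold: "foldD (carrier G) (\<lambda>b x. F b \<otimes> x) (F a) S = F a \<otimes> finprod G F S"
    if "finite S" "S \<subseteq> A" for S
    using that
  proof (induction S)
    case empty
    then show ?case using F a by (auto simp: foldD_empty Pi_iff)
  next
    case (insert b S)
    then have FS: "F \<in> S \<rightarrow> carrier G" "F b \<in> carrier G" "F a \<in> carrier G"
      using F a by (auto simp: Pi_iff)
    have "foldD (carrier G) (\<lambda>b x. F b \<otimes> x) (F a) (insert b S) = F b \<otimes> (F a \<otimes> finprod G F S)"
      using insert FS by (subst foldD_insert) auto
    then show ?case using insert FS by (simp add: m_lcomm)
  qed
  have "semigroup_prod G F A = F a \<otimes> finprod G F (A - {a})"
    using fold[of "A - {a}"] \<open>finite A\<close> by (simp add: semigroup_prod_def a_def Let_def)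
  also have "\<dots> = finprod G F (insert a (A - {a}))"
    using F a \<open>finite A\<close> by (subst finprod_insert) (auto simp: Pi_iff)
  finally show ?thesis using a by (simp add: insert_absorb)
qed

lemma finprod_integer_mod_group:
  assumes "finite A" "F \<in> A \<rightarrow> carrier (integer_mod_group m)"
  shows "finprod (integer_mod_group m) F A = sum F A mod int m"
proof -
  interpret comm_group "integer_mod_group m" by (rule abelian_integer_mod_group)
  show ?thesis
    using assms
  proof (induction A)
    case (insert a A)
    then have "finprod (integer_mod_group m) F (insert a A) =
        F a \<otimes>\<^bsub>integer_mod_group m\<^esub> finprod (integer_mod_group m) F A"
      by (intro finprod_insert) auto
    moreover have "finprod (integer_mod_group m) F A = sum F A mod int m"
      using insert by auto
    ultimately show ?case using insert.hyps by (simp add: mod_add_right_eq)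
  qed simp
qed

lemma semigroup_prod_integer_mod_group:
  assumes "finite A" "A \<noteq> {}" "F \<in> A \<rightarrow> carrier (integer_mod_group m)"
  shows "semigroup_prod (integer_mod_group m) F A = sum F A mod int m"
  using comm_monoid.semigroup_prod_eq_finprod[OF comm_group.axioms(1) assms]
    finprod_integer_mod_group[OF assms(1,3)] by simp

lemma monoid_if_bij_hom:
  assumes "monoid G" "h \<in> hom G H" "h ` carrier G = carrier H" "h \<one>\<^bsub>G\<^esub> = \<one>\<^bsub>H\<^esub>"
  shows "monoid H"
  using monoid.hom_imp_img_monoid[OF assms(1,2)] assms(3,4) by simp

section \<open>Forgetting the signs is multiplicative\<close>

definition abs_stacked :: "int stacked \<Rightarrow> nat stacked"
  where "abs_stacked = map_stacked (nat \<circ> abs)"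

lemma abs_stacked_rows:
  "abs_stacked (first_rows x) = first_rows (abs_point x)"
  "abs_stacked (last_rows x) = last_rows (abs_point x)"
  "abs_stacked (outer_rows x) = outer_rows (abs_point x)"
  by (cases x; simp add: abs_stacked_def abs_point_def)+

lemma abs_stacked_eq_iff: "abs_stacked u = abs_stacked v \<longleftrightarrow> v = u \<or> v = map_stacked uminus u"
  by (cases u; cases v) (auto simp: abs_stacked_def nat_eq_iff abs_if split: if_splits)

lemma abs_stacked_eq_rowsD:
  "abs_stacked u = first_rows a \<Longrightarrow> \<exists>x. u = first_rows x \<and> abs_point x = a"
  "abs_stacked u = last_rows a \<Longrightarrow> \<exists>x. u = last_rows x \<and> abs_point x = a"
  "abs_stacked u = outer_rows a \<Longrightarrow> \<exists>x. u = outer_rows x \<and> abs_point x = a"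
proof -
  have abs_point_rows: "abs_point (Inl i) = Inl (nat \<bar>i\<bar>)" "abs_point (Inr i) = Inr (nat \<bar>i\<bar>)" for i
    by (simp_all add: abs_point_def)
  show "abs_stacked u = first_rows a \<Longrightarrow> \<exists>x. u = first_rows x \<and> abs_point x = a"
    by (cases a; cases u)
      (auto simp: abs_stacked_def intro: exI[of _ "Inl _"] exI[of _ "Inr _"] abs_point_rows)
  show "abs_stacked u = last_rows a \<Longrightarrow> \<exists>x. u = last_rows x \<and> abs_point x = a"
    by (cases a; cases u)
      (auto simp: abs_stacked_def intro: exI[of _ "Inl _"] exI[of _ "Inr _"] abs_point_rows)
  show "abs_stacked u = outer_rows a \<Longrightarrow> \<exists>x. u = outer_rows x \<and> abs_point x = a"
    by (cases a; cases u)
      (auto simp: abs_stacked_def intro: exI[of _ "Inl _"] exI[of _ "Inr _"] abs_point_rows)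
qed

lemma same_block_abs_diagram:
  "(x, y) \<in> same_block D \<Longrightarrow> (abs_point x, abs_point y) \<in> same_block (abs_diagram D)"
  unfolding same_block_def abs_diagram_def by blast

text \<open>
  A block downstairs has a lift through every point \<open>x\<close> over it: if a given lift contains \<open>-x\<close>
  instead, its negative contains \<open>x\<close>.
\<close>

lemma same_block_abs_diagram_lift:
  assumes D: "negate_diagram D = D" and xb: "(abs_point x, b) \<in> same_block (abs_diagram D)"
  shows "\<exists>y. abs_point y = b \<and> (x, y) \<in> same_block D"
proof -
  obtain B x' y' where B: "B \<in> D" "x' \<in> B" "y' \<in> B" "abs_point x' = abs_point x" "abs_point y' = b"
    using xb unfolding same_block_def abs_diagram_def by fastforce
  then consider "x = x'" | "x = negate x'" by (metis abs_point_eq_iff)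
  then show ?thesis
  proof cases
    case 1
    then show ?thesis using B unfolding same_block_def by blast
  next
    case 2
    then have "x \<in> negate ` B" "negate y' \<in> negate ` B" using B by blast+
    then have "(x, negate y') \<in> same_block D"
      using negate_image_in_diagram[OF D B(1)] unfolding same_block_def by blast
    moreover have "abs_point (negate y') = b" using B(5) by simp
    ultimately show ?thesis by blast
  qed
qed

lemma connected_rel_abs_diagram:
  assumes "(u, v) \<in> connected_rel D E"
  shows "(abs_stacked u, abs_stacked v) \<in> connected_rel (abs_diagram D) (abs_diagram E)"
proof -
  have "map_prod abs_stacked abs_stacked ` same_block (stacked_blocks D E)
      \<subseteq> same_block (stacked_blocks (abs_diagram D) (abs_diagram E))"
    unfolding same_block_stacked_blocks image_Un
    using same_block_abs_diagram by (intro Un_mono) (force simp: abs_stacked_rows)+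
  then have "map_prod abs_stacked abs_stacked ` same_block (stacked_blocks D E)
      \<subseteq> (same_block (stacked_blocks (abs_diagram D) (abs_diagram E)))\<^sup>*"
    by (rule order_trans) (simp add: r_into_rtrancl subrelI)
  with assms show ?thesis
    unfolding connected_rel_eq by (rule rtrancl_image_subset)
qed

text \<open>
  Path lifting: the edges of a path downstairs are lifted one after the other, each one from the
  endpoint of the lift of the previous one.
\<close>

lemma connected_rel_lift:
  assumes D: "negate_diagram D = D" and E: "negate_diagram E = E"
    and "(abs_stacked u, w) \<in> connected_rel (abs_diagram D) (abs_diagram E)"
  shows "\<exists>v. abs_stacked v = w \<and> (u, v) \<in> connected_rel D E"
  using assms(3) unfolding connected_rel_eq
proof (induction rule: rtrancl_induct)
  case base
  then show ?case by blast
next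
  case (step w z)
  then obtain v where v: "abs_stacked v = w"
    "(u, v) \<in> (same_block (stacked_blocks D E))\<^sup>*" by blast
  have "\<exists>v'. abs_stacked v' = z \<and> (v, v') \<in> same_block (stacked_blocks D E)"
    using step.hyps(2) unfolding same_block_stacked_blocks
  proof
    assume "(w, z) \<in> map_prod first_rows first_rows ` same_block (abs_diagram D)"
    then obtain a b where ab: "w = first_rows a" "z = first_rows b" "(a, b) \<in> same_block (abs_diagram D)"
      by auto
    then obtain x where x: "v = first_rows x" "abs_point x = a"
      using abs_stacked_eq_rowsD(1) v(1) by blast
    then obtain y where "abs_point y = b" "(x, y) \<in> same_block D"
      using same_block_abs_diagram_lift[OF D] ab(3) by blast
    then show "\<exists>v'. abs_stacked v' = z \<and>
        (v, v') \<in> map_prod first_rows first_rows ` same_block D \<union>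
          map_prod last_rows last_rows ` same_block E"
      using x(1) ab(2) by (intro exI[of _ "first_rows y"]) (auto simp: abs_stacked_rows)
  next
    assume "(w, z) \<in> map_prod last_rows last_rows ` same_block (abs_diagram E)"
    then obtain a b where ab: "w = last_rows a" "z = last_rows b" "(a, b) \<in> same_block (abs_diagram E)"
      by auto
    then obtain x where x: "v = last_rows x" "abs_point x = a"
      using abs_stacked_eq_rowsD(2) v(1) by blast
    then obtain y where "abs_point y = b" "(x, y) \<in> same_block E"
      using same_block_abs_diagram_lift[OF E] ab(3) by blast
    then show "\<exists>v'. abs_stacked v' = z \<and>
        (v, v') \<in> map_prod first_rows first_rows ` same_block D \<union>
          map_prod last_rows last_rows ` same_block E"
      using x(1) ab(2) by (intro exI[of _ "last_rows y"]) (auto simp: abs_stacked_rows)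
  qed
  then obtain v' where "abs_stacked v' = z" "(v, v') \<in> same_block (stacked_blocks D E)" by blast
  then show ?case using rtrancl_into_rtrancl[OF v(2)] by blast
qed

lemma connected_class_abs_diagram:
  assumes "negate_diagram D = D" "negate_diagram E = E"
  shows "connected_rel (abs_diagram D) (abs_diagram E) `` {abs_stacked u} =
    abs_stacked ` (connected_rel D E `` {u})"
  using connected_rel_abs_diagram[of u _ D E] connected_rel_lift[OF assms, of u] by blast

lemma outer_rows_vimage_abs_stacked:
  "outer_rows -` (abs_stacked ` K) = abs_point ` (outer_rows -` K)"
proof (intro equalityI subsetI)
  fix c assume "c \<in> outer_rows -` (abs_stacked ` K)"
  then obtain u where "u \<in> K" "abs_stacked u = outer_rows c" by auto
  then show "c \<in> abs_point ` (outer_rows -` K)" using abs_stacked_eq_rowsD(3) by blast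
next
  fix c assume "c \<in> abs_point ` (outer_rows -` K)"
  then obtain x where "outer_rows x \<in> K" "c = abs_point x" by auto
  then show "c \<in> outer_rows -` (abs_stacked ` K)" using abs_stacked_rows(3)[of x] by force
qed

lemma abs_diagram_concatenation:
  assumes D: "D \<in> carrier (BrB n)" and E: "E \<in> carrier (BrB n)"
  shows "abs_diagram (concatenation D E) = concatenation (abs_diagram D) (abs_diagram E)"
proof -
  note parts = partition_on_abs_diagram
  have "concatenation (abs_diagram D) (abs_diagram E) =
      (\<lambda>x. outer_rows -`
          (connected_rel (abs_diagram D) (abs_diagram E) `` {outer_rows (abs_point x)})) `
        (signed_points n <+> signed_points n)"
    unfolding concatenation_eq[OF parts[OF D] parts[OF E]]
      abs_point_image_signed_points[symmetric] image_image ..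
  also have "\<dots> = (\<lambda>x. abs_point ` (outer_rows -` (connected_rel D E `` {outer_rows x}))) `
        (signed_points n <+> signed_points n)"
    using connected_class_abs_diagram[OF BrB_memD(3)[OF D] BrB_memD(3)[OF E]]
    by (simp add: outer_rows_vimage_abs_stacked flip: abs_stacked_rows)
  also have "\<dots> = abs_diagram (concatenation D E)"
    unfolding abs_diagram_def concatenation_eq[OF BrB_memD(1)[OF D] BrB_memD(1)[OF E]] image_image ..
  finally show ?thesis by simp
qed

text \<open>
  This is stated for an arbitrary embedding \<open>r\<close> of a diagram into the stack, lying over \<open>r'\<close>, so that
  it serves for both factors. Injectivity on \<open>K\<close> ensures that the two lifts of a pair do not both lie
  in \<open>K\<close>; that one of them does holds because \<open>K\<close> contains a point over the pair.
\<close>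

lemma bij_betw_contributing_blocks:
  fixes r :: "int + int \<Rightarrow> int stacked" and r' :: "nat + nat \<Rightarrow> nat stacked"
  assumes D: "D \<in> carrier (BrB n)" and K: "inj_on abs_stacked K"
    and r: "inj r" "\<And>x. abs_stacked (r x) = r' (abs_point x)"
    and lift: "\<And>u c. abs_stacked u = r' c \<Longrightarrow> \<exists>x. u = r x \<and> abs_point x = c"
    and saturated: "\<And>B. B \<in> D \<Longrightarrow> B \<inter> r -` K \<noteq> {} \<Longrightarrow> B \<subseteq> r -` K"
  shows "bij_betw ((`) abs_point) {B \<in> D. B \<subseteq> r -` K}
    {C \<in> pair_blocks (abs_diagram D). r' ` C \<subseteq> abs_stacked ` K}"
proof (rule bij_betw_imageI)
  have inj: "inj_on abs_point (r -` K)"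
  proof (rule inj_onI)
    fix x y assume "x \<in> r -` K" "y \<in> r -` K" "abs_point x = abs_point y"
    then have "r x = r y" using r(2) by (intro inj_onD[OF K]) simp_all
    then show "x = y" using r(1) by (simp add: inj_eq)
  qed
  show "inj_on ((`) abs_point) {B \<in> D. B \<subseteq> r -` K}"
    using inj_on_image_eq_iff[OF inj] by (intro inj_onI) simp
  show "(`) abs_point ` {B \<in> D. B \<subseteq> r -` K} =
      {C \<in> pair_blocks (abs_diagram D). r' ` C \<subseteq> abs_stacked ` K}"
  proof (intro equalityI subsetI)
    fix C assume "C \<in> (`) abs_point ` {B \<in> D. B \<subseteq> r -` K}"
    then obtain B where B: "B \<in> D" "B \<subseteq> r -` K" "C = abs_point ` B" by blast
    have "card C = 2"
      using B BrB_memD(2)[OF D B(1)] card_image[OF inj_on_subset[OF inj B(2)]] by simp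
    moreover have "r' ` C \<subseteq> abs_stacked ` K"
      using B(2,3) r(2) by (auto simp flip: r(2))
    ultimately show "C \<in> {C \<in> pair_blocks (abs_diagram D). r' ` C \<subseteq> abs_stacked ` K}"
      using B(1,3) by (simp add: pair_blocks_def abs_diagram_def)
  next
    fix C assume C: "C \<in> {C \<in> pair_blocks (abs_diagram D). r' ` C \<subseteq> abs_stacked ` K}"
    then obtain B where B: "B \<in> D" "C = abs_point ` B"
      by (auto simp: pair_blocks_def abs_diagram_def)
    obtain b where b: "b \<in> B" using BrB_memD(2)[OF D B(1)] by fastforce
    then have "r' (abs_point b) \<in> abs_stacked ` K" using C B(2) by blast
    then obtain u where "u \<in> K" "abs_stacked u = r' (abs_point b)" by auto
    then obtain x where x: "r x \<in> K" "abs_point x = abs_point b" using lift by blast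
    obtain B' where B': "B' \<in> D" "x \<in> B'" "C = abs_point ` B'"
    proof (cases "x = b")
      case True
      then show ?thesis using that B b by blast
    next
      case False
      then have "x = negate b" using x(2) by (auto simp: abs_point_eq_iff)
      then have "x \<in> negate ` B" using b by blast
      then show ?thesis
        using that[of "negate ` B"] negate_image_in_diagram[OF BrB_memD(3)[OF D] B(1)] B(2) by simp
    qed
    then have "B' \<subseteq> r -` K" using saturated[OF B'(1)] x(1) by blast
    then show "C \<in> (`) abs_point ` {B \<in> D. B \<subseteq> r -` K}" using B' by blast
  qed
qed

lemma sum_twist_coloring:
  assumes D: "D \<in> carrier (BrB n)"
    and bij: "bij_betw ((`) abs_point) \<D> \<C>" "\<D> \<subseteq> D" "\<C> \<subseteq> pair_blocks (abs_diagram D)"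
  shows "sum (twist_coloring D) \<C> = sum twist \<D>"
proof -
  have "card (abs_point ` B) = 2" if "B \<in> \<D>" for B
    using that bij bij_betwE unfolding pair_blocks_def by blast
  then have "(\<Sum>B\<in>\<D>. twist_coloring D (abs_point ` B)) = sum twist \<D>"
    using twist_coloring_apply[OF D] bij(2) by (intro sum.cong) auto
  then show ?thesis using sum.reindex_bij_betw[OF bij(1)] by metis
qed

lemma component_of_block:
  assumes PQ: "partition_on (V <+> V) P" "partition_on (V <+> V) Q"
    and C: "C \<in> concatenation P Q" "c \<in> C"
  shows "component_of P Q C = connected_rel P Q `` {outer_rows c}"
proof
  have "(outer_rows c, outer_rows c') \<in> connected_rel P Q" if "c' \<in> C" for c'
    using same_block_concatenation[OF PQ, of c c'] C that by (auto simp: same_block_def)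
  then show "component_of P Q C \<subseteq> connected_rel P Q `` {outer_rows c}"
    unfolding component_of_def using connected_rel_trans by blast
  show "connected_rel P Q `` {outer_rows c} \<subseteq> component_of P Q C"
    unfolding component_of_def using C(2) by blast
qed

text \<open>
  Suppose that the class contains a vertex together with its negative. Applying negation to a path
  from \<open>x\<close> to this vertex shows that the class contains \<open>-x\<close> as well. Then the block is \<open>{x, -x}\<close>,
  whose image is a singleton.
\<close>

lemma inj_on_abs_stacked_class:
  assumes D: "D \<in> carrier (BrB n)" and E: "E \<in> carrier (BrB n)"
    and B: "B \<in> concatenation D E" "x \<in> B" "card (abs_point ` B) = 2"
  shows "inj_on abs_stacked (connected_rel D E `` {outer_rows x})"
proof (rule inj_onI, rule ccontr)
  let ?u = "outer_rows x"
  fix v w assume vw: "v \<in> connected_rel D E `` {?u}" "w \<in> connected_rel D E `` {?u}"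
    "abs_stacked v = abs_stacked w" "v \<noteq> w"
  then have "w = map_stacked uminus v" by (auto simp: abs_stacked_eq_iff)
  moreover have "(map_stacked uminus ?u, map_stacked uminus v) \<in> connected_rel D E"
    using connected_rel_negate[OF BrB_memD(3)[OF D] BrB_memD(3)[OF E]] vw(1) by blast
  ultimately have "(?u, map_stacked uminus ?u) \<in> connected_rel D E"
    using vw(2) by (meson Image_singleton_iff connected_rel_sym connected_rel_trans)
  moreover have "map_stacked uminus ?u = outer_rows (negate x)" by (cases x) auto
  ultimately have rel: "(?u, outer_rows (negate x)) \<in> connected_rel D E" by simp
  note DE = concatenation_BrB[OF D E]
  have x: "x \<in> signed_points n <+> signed_points n"
    using block_subset_signed[OF DE B(1)] B(2) by blast
  then have "negate x \<in> signed_points n <+> signed_points n" by (simp only: negate_in_signed_points)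
  then have "(x, negate x) \<in> same_block (concatenation D E)"
    unfolding same_block_concatenation[OF BrB_memD(1)[OF D] BrB_memD(1)[OF E]]
    by (intro conjI x rel)
  then have "negate x \<in> B"
    using partition_block_unique[OF BrB_memD(1)[OF DE] _ B(1) _ B(2)]
    by (auto simp: same_block_def)
  moreover have "card B = 2" using BrB_memD(2)[OF DE B(1)] .
  ultimately have "B = {x, negate x}"
    using B(2) negate_neq[OF x] by (metis card_2_iff doubleton_eq_iff insertE singletonD)
  then show False using B(3) by simp
qed

text \<open>
  The contributing blocks downstairs correspond to the blocks upstairs inside the class \<open>K\<close>. Adding
  the bits of all their points counts the outer points, which form the block \<open>B\<close> of the product, once
  and the middle points twice.
\<close>

lemma twist_coloring_concatenation:
  assumes D: "D \<in> carrier (BrB n)" and E: "E \<in> carrier (BrB n)"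
    and C: "C \<in> pair_blocks (concatenation (abs_diagram D) (abs_diagram E))"
  shows "twist_coloring (concatenation D E) C =
    semigroup_prod (integer_mod_group 2) (case_sum (twist_coloring D) (twist_coloring E))
      (first_contributing (abs_diagram D) (abs_diagram E) C <+>
       last_contributing (abs_diagram D) (abs_diagram E) C)"
proof -
  note DE = concatenation_BrB[OF D E]
  note partD = BrB_memD(1)[OF D] and partE = BrB_memD(1)[OF E]
  note parts = partition_on_abs_diagram
  have C2: "card C = 2" and C_in: "C \<in> concatenation (abs_diagram D) (abs_diagram E)"
    using C by (auto simp: pair_blocks_def)
  then obtain B where B: "B \<in> concatenation D E" "C = abs_point ` B"
    unfolding abs_diagram_concatenation[OF D E, symmetric] by (auto simp: abs_diagram_def)
  have "B \<noteq> {}" using B(1) by (auto simp: concatenation_def)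
  then obtain x where xB: "x \<in> B" by blast
  have x: "x \<in> signed_points n <+> signed_points n"
    using block_subset_signed[OF DE B(1)] xB by blast
  define K where "K = connected_rel D E `` {outer_rows x}"
  have BK: "B = outer_rows -` K"
  proof (rule partition_block_unique[OF BrB_memD(1)[OF DE] B(1) _ xB])
    show "outer_rows -` K \<in> concatenation D E"
      unfolding K_def concatenation_eq[OF partD partE] using x by blast
    show "x \<in> outer_rows -` K" by (simp add: K_def connected_rel_refl)
  qed
  have comp: "component_of (abs_diagram D) (abs_diagram E) C = abs_stacked ` K"
    using component_of_block[OF parts[OF D] parts[OF E] C_in, of "abs_point x"] B(2) xB
      connected_class_abs_diagram[OF BrB_memD(3)[OF D] BrB_memD(3)[OF E], of "outer_rows x"]
    by (simp add: K_def abs_stacked_rows)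
  have injK: "inj_on abs_stacked K"
    using inj_on_abs_stacked_class[OF D E B(1) xB] B(2) C2 by (simp add: K_def)
  let ?D = "{B \<in> D. B \<subseteq> first_rows -` K}" and ?E = "{B \<in> E. B \<subseteq> last_rows -` K}"
  let ?first = "first_contributing (abs_diagram D) (abs_diagram E) C"
  let ?last = "last_contributing (abs_diagram D) (abs_diagram E) C"
  have bijD: "bij_betw ((`) abs_point) ?D ?first"
    unfolding first_contributing_def comp
    by (rule bij_betw_contributing_blocks[OF D injK inj_rows(1) abs_stacked_rows(1)
          abs_stacked_eq_rowsD(1)])
      (use connected_rel_first_blocks in \<open>simp_all add: K_def\<close>)
  have bijE: "bij_betw ((`) abs_point) ?E ?last"
    unfolding last_contributing_def comp
    by (rule bij_betw_contributing_blocks[OF E injK inj_rows(2) abs_stacked_rows(2)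
          abs_stacked_eq_rowsD(2)])
      (use connected_rel_last_blocks in \<open>simp_all add: K_def\<close>)
  have sumD: "sum (twist_coloring D) ?first = sum twist ?D"
    by (rule sum_twist_coloring[OF D bijD]) (auto simp: first_contributing_def)
  have sumE: "sum (twist_coloring E) ?last = sum twist ?E"
    by (rule sum_twist_coloring[OF E bijE]) (auto simp: last_contributing_def)
  have finD: "finite D" and finE: "finite E"
    using finite_elements[OF _ partD] finite_elements[OF _ partE] finite_signed_points by auto
  then have fin: "finite ?first" "finite ?last"
    using bij_betw_finite[OF bijD] bij_betw_finite[OF bijE] by simp_all
  \<comment> \<open>The semigroup product has no meaningful value on the empty set. The block through
  the outer vertex \<open>x\<close> contributes; it belongs to the first factor if \<open>x\<close> lies in the
  top row and to the last factor if \<open>x\<close> lies in the bottom row.\<close>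
  have ne: "?first <+> ?last \<noteq> {}"
  proof (cases x)
    case (Inl i)
    then obtain B' where B': "B' \<in> D" "x \<in> B'" using x partition_onD1[OF partD] by blast
    have "x \<in> first_rows -` K" using Inl connected_rel_refl[of "outer_rows x" D E] by (simp add: K_def)
    then have "B' \<in> ?D"
      using connected_rel_first_blocks[of B' D E "outer_rows x"] B' by (auto simp: K_def)
    then show ?thesis using bij_betwE[OF bijD] by blast
  next
    case (Inr i)
    then obtain B' where B': "B' \<in> E" "x \<in> B'" using x partition_onD1[OF partE] by blast
    have "x \<in> last_rows -` K" using Inr connected_rel_refl[of "outer_rows x" D E] by (simp add: K_def)
    then have "B' \<in> ?E"
      using connected_rel_last_blocks[of B' E D "outer_rows x"] B' by (auto simp: K_def)
    then show ?thesis using bij_betwE[OF bijE] by blast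
  qed
  have colors: "case_sum (twist_coloring D) (twist_coloring E) \<in>
      ?first <+> ?last \<rightarrow> carrier (integer_mod_group 2)"
    by (auto simp: first_contributing_def last_contributing_def carrier_integer_mod_group
        twist_coloring_def twist_def)
  have "semigroup_prod (integer_mod_group 2) (case_sum (twist_coloring D) (twist_coloring E))
      (?first <+> ?last) = sum (case_sum (twist_coloring D) (twist_coloring E)) (?first <+> ?last) mod 2"
    using semigroup_prod_integer_mod_group[OF _ ne colors] fin by simp
  also have "\<dots> = (sum twist ?D + sum twist ?E) mod 2"
    using fin by (simp add: sum.Plus comp_def sumD sumE)
  also have "\<dots> = ((\<Sum>B\<in>?D. sum point_bit B) + (\<Sum>B\<in>?E. sum point_bit B)) mod 2"
    unfolding twist_def by (intro mod_add_cong mod_sum_eq)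
  also have "\<dots> = (sum point_bit B + 2 * (\<Sum>i\<in>Middle -` K. sign_bit i)) mod 2"
    unfolding BK K_def
    by (subst sum_blocks_in_class[OF partD partE finite_signed_points x]) (rule refl)
  also have "\<dots> = twist B" by (simp add: twist_def)
  also have "\<dots> = twist_coloring (concatenation D E) C"
    using twist_coloring_apply[OF DE B(1)] B(2) C2 by simp
  finally show ?thesis ..
qed

lemma abs_diagram_hom:
  "(\<lambda>D. (abs_diagram D, twist_coloring D)) \<in> hom (BrB n) (APB n (integer_mod_group 2))"
proof (rule homI)
  fix D E assume D: "D \<in> carrier (BrB n)" and E: "E \<in> carrier (BrB n)"
  have "twist_coloring (concatenation D E) =
      (\<lambda>C \<in> pair_blocks (concatenation (abs_diagram D) (abs_diagram E)).
        semigroup_prod (integer_mod_group 2) (case_sum (twist_coloring D) (twist_coloring E))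
          (first_contributing (abs_diagram D) (abs_diagram E) C <+>
           last_contributing (abs_diagram D) (abs_diagram E) C))" (is "_ = ?color")
  proof
    fix C
    show "twist_coloring (concatenation D E) C = ?color C"
      using twist_coloring_concatenation[OF D E, of C] abs_diagram_concatenation[OF D E]
      by (cases "C \<in> pair_blocks (concatenation (abs_diagram D) (abs_diagram E))")
        (simp_all add: twist_coloring_def)
  qed
  then show "(abs_diagram (D \<otimes>\<^bsub>BrB n\<^esub> E), twist_coloring (D \<otimes>\<^bsub>BrB n\<^esub> E)) =
      (abs_diagram D, twist_coloring D) \<otimes>\<^bsub>APB n (integer_mod_group 2)\<^esub>
      (abs_diagram E, twist_coloring E)"
    using abs_diagram_concatenation[OF D E] by (simp add: BrB_def APB_def APB_mult_def)
qed (rule abs_diagram_in_APB)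

text \<open>
  In a block of the identity both points have the same sign, so every color is 0.
\<close>

lemma abs_diagram_one:
  "(abs_diagram \<one>\<^bsub>BrB n\<^esub>, twist_coloring \<one>\<^bsub>BrB n\<^esub>) = \<one>\<^bsub>APB n (integer_mod_group 2)\<^esub>"
proof -
  let ?I = "identity_diagram (signed_points n)"
  have pairs: "pair_blocks (identity_diagram V) = identity_diagram V" for V :: "nat set"
    by (auto simp: pair_blocks_def identity_diagram_def)
  have abs: "abs_point ` {Inl i, Inr i} = {Inl (nat \<bar>i\<bar>), Inr (nat \<bar>i\<bar>)}" for i
    by (simp add: abs_point_def)
  have "(\<lambda>i. nat \<bar>i\<bar>) ` signed_points n = {1..n}"
  proof (intro equalityI subsetI)
    fix i assume "i \<in> {1..n}"
    then show "i \<in> (\<lambda>i. nat \<bar>i\<bar>) ` signed_points n"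
      by (intro image_eqI[of _ _ "int i"]) (auto simp: signed_points_def)
  qed (auto simp: signed_points_def)
  then have diagram: "abs_diagram ?I = identity_diagram {1..n}"
    unfolding abs_diagram_def identity_diagram_def image_image abs
    by (subst (asm) eq_commute) (simp add: image_image)
  have "twist_coloring ?I C = 0" if C: "C \<in> identity_diagram {1..n}" for C
  proof -
    obtain B where B: "B \<in> ?I" "C = abs_point ` B"
      using C unfolding diagram[symmetric] abs_diagram_def by blast
    then obtain i where i: "B = {Inl i, Inr i}" by (auto simp: identity_diagram_def)
    have "twist_coloring ?I C = twist B"
      using twist_coloring_apply[OF identity_diagram_BrB B(1)] B(2) C pairs[of "{1..n}"]
      by (auto simp: pair_blocks_def)
    also have "\<dots> = 0" by (simp add: i twist_pair)
    finally show ?thesis .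
  qed
  then have "twist_coloring ?I = (\<lambda>C \<in> identity_diagram {1..n}. 0)"
    by (auto simp: fun_eq_iff twist_coloring_def diagram pairs)
  then show ?thesis using diagram by (simp add: BrB_def APB_def)
qed

theorem proposition25:
  fixes n :: nat
  shows "monoid (BrB n) \<and> monoid (APB n (integer_mod_group 2)) \<and>
    BrB n \<cong> APB n (integer_mod_group 2)"
proof (intro conjI)
  let ?h = "\<lambda>D. (abs_diagram D, twist_coloring D)"
  show "monoid (BrB n)" by (rule monoid_BrB)
  then show "monoid (APB n (integer_mod_group 2))"
    using monoid_if_bij_hom[OF _ abs_diagram_hom] bij_betw_imp_surj_on[OF bij_betw_abs_diagram]
      abs_diagram_one by blast
  have "?h \<in> iso (BrB n) (APB n (integer_mod_group 2))"
    using abs_diagram_hom bij_betw_abs_diagram by (rule isoI)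
  then show "BrB n \<cong> APB n (integer_mod_group 2)" by (rule is_isoI)
qed

end
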